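(* Suppose that all the eigenvalues of the boundary value problem $$-y''+q(x)y=\lambda y\ (0<x<1),\qquad y(0)\cos\beta=y'(0)\sin\beta,\qquad (a\lambda+b)y(1)=(c\lambda+d)y'(1)$$ are real and that, except for one double eigenvalue $\lambda_k=\lambda_{k+1}$, all of them are simple. Let $y_n=y(\cdot,\lambda_n)$ for $n\neq k+1$ be the eigenfunctions, and let $y_{k+1}=\tilde y_{k+1}+Cy_k$ with $C\in\mathbb{R}$ be an associated function of $y_k$. Then the system $$\{y_n\}\quad (n=0,1,\ldots;\ n\neq k)$$ is minimal in $L_2(0,1)$ if and only if $$C\neq-\frac{\omega'''(\lambda_k)}{3\,\omega''(\lambda_k)}.$$
   Context: Here $q:[0,1]\to\mathbb{R}$ is continuous, $0\le\beta<\pi$, and $a,b,c,d\in\mathbb{R}$ satisfy $ad-bc<0$. For $\lambda\in\mathbb{C}$ let $y(x,\lambda)$ be the solution of $-y''+q(x)y=\lambda y$ on $[0,1]$ with $y(0,\lambda)=\sin\beta$, $y'(0,\lambda)=\cos\beta$ (prime on $y$ means $d/dx$), and define the characteristic function $$\omega(\lambda)=(a\lambda+b)y(1,\lambda)-(c\lambda+d)y'(1,\lambda).$$ Primes on $\omega$ denote derivatives in $\lambda$. The eigenvalues are the zeros of $\omega$, counted with algebraic multiplicity (the order as a zero of $\omega$). They form an infinite sequence $\{\lambda_n\}_{n\ge0}$ indexed by non-decreasing real parts, whose only accumulation point is $+\infty$. If $\lambda_k=\lambda_{k+1}$ is a double eigenvalue, with eigenfunction $y_k=y(\cdot,\lambda_k)$,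 an associated function $y_{k+1}$ of $y_k$ is a solution of $-y_{k+1}''+qy_{k+1}=\lambda_ky_{k+1}+y_k$, $y_{k+1}(0)\cos\beta=y_{k+1}'(0)\sin\beta$, $(a\lambda_k+b)y_{k+1}(1)+ay_k(1)=(c\lambda_k+d)y_{k+1}'(1)+cy_k'(1)$. One particular associated function is $\tilde y_{k+1}(x)=\frac{\partial y}{\partial\lambda}(x,\lambda_k)$, and every associated function has the form $y_{k+1}=\tilde y_{k+1}+Cy_k$ for some constant $C$. A system in $L_2(0,1)$ is minimal if none of its elements lies in the closed linear span of the others. *)

theory Defs
  imports "HOL-Complex_Analysis.Complex_Analysis"
begin

definition sl_solution ::
    "(real \<Rightarrow> real) \<Rightarrow> complex \<Rightarrow> (real \<Rightarrow> complex) \<Rightarrow> (real \<Rightarrow> complex) \<Rightarrow> bool" where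
  \<comment> \<open>\<open>u\<close> solves \<open>- u'' + q u = lam u\<close> on \<open>[0,1]\<close> (one-sided derivatives at the
      end points) and \<open>du\<close> is its derivative.\<close>
  "sl_solution q lam u du \<longleftrightarrow>
     (\<exists>ddu. \<forall>x\<in>{0..1}.
        (u has_vector_derivative du x) (at x within {0..1}) \<and>
        (du has_vector_derivative ddu x) (at x within {0..1}) \<and>
        - ddu x + complex_of_real (q x) * u x = lam * u x)"

definition char_fun ::
    "real \<Rightarrow> real \<Rightarrow> real \<Rightarrow> real \<Rightarrow> (real \<Rightarrow> complex \<Rightarrow> complex) \<Rightarrow>
     (real \<Rightarrow> complex \<Rightarrow> complex) \<Rightarrow> complex \<Rightarrow> complex" where
  "char_fun a b c d y dy lam =
     (complex_of_real a * lam + complex_of_real b) * y 1 lam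
     - (complex_of_real c * lam + complex_of_real d) * dy 1 lam"

definition zero_enumeration :: "(complex \<Rightarrow> complex) \<Rightarrow> (nat \<Rightarrow> complex) \<Rightarrow> bool" where
  \<comment> \<open>\<open>lam\<close> lists the zeros of \<open>w\<close>, each repeated according to its order,
      by non-decreasing real part.\<close>
  "zero_enumeration w lam \<longleftrightarrow>
     range lam = {z. w z = 0} \<and>
     (\<forall>z. w z = 0 \<longrightarrow> finite {n. lam n = z} \<and> int (card {n. lam n = z}) = zorder w z) \<and>
     mono (\<lambda>n. Re (lam n))"

text \<open>Elements of \<open>L\<^sub>2(0,1)\<close> are represented by functions; their values outside
  \<open>(0,1)\<close> and on null sets play no role in the notions below.\<close>

definition L2_01 :: "(real \<Rightarrow> complex) set" where
  "L2_01 = {f \<in> borel_measurable (lebesgue_on {0<..<1}).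
              integrable (lebesgue_on {0<..<1}) (\<lambda>x. (cmod (f x))\<^sup>2)}"

definition L2_norm :: "(real \<Rightarrow> complex) \<Rightarrow> real" where
  "L2_norm f = sqrt (LINT x|lebesgue_on {0<..<1}. (cmod (f x))\<^sup>2)"

definition L2_closed_span :: "('i \<Rightarrow> real \<Rightarrow> complex) \<Rightarrow> 'i set \<Rightarrow> (real \<Rightarrow> complex) set" where
  "L2_closed_span F I =
     {f \<in> L2_01. \<forall>e>0. \<exists>J \<alpha>. finite J \<and> J \<subseteq> I \<and>
        L2_norm (\<lambda>x. f x - (\<Sum>j\<in>J. \<alpha> j * F j x)) < e}"

definition L2_minimal :: "('i \<Rightarrow> real \<Rightarrow> complex) \<Rightarrow> 'i set \<Rightarrow> bool" where
  "L2_minimal F I \<longleftrightarrow>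
     (\<forall>i\<in>I. F i \<in> L2_01) \<and> (\<forall>i\<in>I. F i \<notin> L2_closed_span F (I - {i}))"

definition root_system ::
    "(real \<Rightarrow> complex \<Rightarrow> complex) \<Rightarrow> (nat \<Rightarrow> complex) \<Rightarrow> nat \<Rightarrow> real \<Rightarrow> nat \<Rightarrow> real \<Rightarrow> complex" where
  \<comment> \<open>Eigenfunctions \<open>y(\<cdot>, lam n)\<close>, except that index \<open>k + 1\<close> carries the associated
      function \<open>\<partial>y/\<partial>\<lambda>(\<cdot>, lam k) + C y(\<cdot>, lam k)\<close>.\<close>
  "root_system y lam k C n =
     (if n = Suc k
      then (\<lambda>x. deriv (\<lambda>\<mu>. y x \<mu>) (lam k) + complex_of_real C * y x (lam k))
      else (\<lambda>x. y x (lam n)))"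

end

theory Submission
  imports Defs
begin

text \<open>Lagrange's identity turns \<open>\<integral> y(x,\<lambda>) y(x,\<mu>) dx\<close> into an expression in \<open>\<omega>\<close> and
  \<open>M = a y(1) - c y'(1)\<close>, which vary analytically in \<open>\<lambda>\<close> since the difference quotients of
  \<open>y\<close> in \<open>\<lambda>\<close> are Cauchy by an energy estimate. Unless \<open>C = - \<omega>''' / (3 \<omega>'')\<close>, this
  expression yields an explicit biorthogonal system, hence minimality. For the exceptional \<open>C\<close>, the
  residue of \<open>y(x,\<lambda>) / \<omega>(\<lambda>)\<close> at the double eigenvalue is a multiple of the associated function
  \<open>y_{k+1}\<close> alone; the integrals of \<open>y / \<omega>\<close> over suitable growing circles tend to 0 in
  \<open>L\<^sub>2\<close>, so \<open>y_{k+1}\<close> is a limit of linear combinations of the remaining eigenfunctions.\<close>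

section \<open>Analytic dependence on the spectral parameter\<close>

text \<open>For distinct eigenvalues the identity reduces to
  \<open>\<sigma> * integral y_n y_m = M_n * M_m\<close>. Since the eigenparameter enters the
  boundary condition, the Gram matrix of the eigenfunctions is diagonal plus rank one, and the
  functions left at the double eigenvalue \<open>\<kappa>\<close> must absorb the rank one part.
  Write \<open>\<omega> = (z - \<kappa>)\<^sup>2 * g\<close>. Then \<open>\<omega>'' = 2 g\<close>
  and \<open>\<omega>''' = 6 g'\<close> at \<open>\<kappa>\<close>, so the critical \<open>C\<close>
  is \<open>- g' / g\<close>. The quantity \<open>g' + C g\<close> occurs twice: up to the factor
  \<open>- (M \<kappa>)\<^sup>2\<close> it is the determinant of the linear system behind the
  biorthogonal functions, and up to a factor it is the coefficient of \<open>y_k\<close> in the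
  residue of \<open>y / \<omega>\<close> once this is expressed by \<open>y_{k+1}\<close> and
  \<open>y_k\<close>. On the circles \<open>y / \<omega>\<close> is only of the order of the inverse
  radius, which merely balances their length. What tends to 0 is the factor
  \<open>exp (- \<bar>Im s\<bar> * (1 - x))\<close> with \<open>s\<^sup>2 = \<lambda>\<close>, and
  this only for \<open>x < 1\<close> and off the positive real axis. Therefore dominated convergence
  is used twice, along the circle and in \<open>x\<close>.\<close>

lemma nonneg_deriv_imp_le_on_interval:
  fixes f f' :: "real \<Rightarrow> real"
  assumes der: "\<And>x. x \<in> {0..1} \<Longrightarrow> (f has_real_derivative f' x) (at x within {0..1})"
    and nn: "\<And>x. x \<in> {0..1} \<Longrightarrow> 0 \<le> f' x"
    and xy: "0 \<le> x" "x \<le> z" "z \<le> 1"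
  shows "f x \<le> f z"
proof (rule DERIV_nonneg_imp_increasing_open[OF xy(2)])
  fix t assume t: "x < t" "t < z"
  hence t01: "t \<in> {0<..<1}" using xy by auto
  have "(f has_real_derivative f' t) (at t)"
    using der[of t] t01 at_within_Icc_at[of 0 t 1] by auto
  thus "\<exists>y. DERIV f t :> y \<and> y \<ge> 0" using nn[of t] t01 by auto
next
  have "continuous_on {0..1} f"
    using der DERIV_continuous_on by blast
  thus "continuous_on {x..z} f" using xy by (auto elim: continuous_on_subset)
qed

text \<open>Gronwall's argument: Cauchy-Schwarz and AM-GM give
  \<open>\<bar>e'\<bar> \<le> (Q + 2) * e + F\<^sup>2\<close>. The forward bound is behind the
  analyticity in the spectral parameter; the backward one is there to exclude zero Cauchy data at
  1.\<close>

lemma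
  fixes v dv ddv :: "real \<Rightarrow> 'a::real_inner"
  assumes v: "\<And>x. x \<in> {0..1} \<Longrightarrow> (v has_vector_derivative dv x) (at x within {0..1})"
    and dv: "\<And>x. x \<in> {0..1} \<Longrightarrow> (dv has_vector_derivative ddv x) (at x within {0..1})"
    and bd: "\<And>x. x \<in> {0..1} \<Longrightarrow> norm (ddv x) \<le> Q * norm (v x) + F"
    and Q: "0 \<le> Q" and F: "0 \<le> F"
  defines "e \<equiv> \<lambda>x. (norm (v x))\<^sup>2 + (norm (dv x))\<^sup>2"
  shows second_order_energy_forward: "x \<in> {0..1} \<Longrightarrow> e x \<le> exp (Q + 2) * (e 0 + F\<^sup>2)"
    and second_order_energy_backward: "F = 0 \<Longrightarrow> e 0 \<le> exp (Q + 2) * e 1"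
proof -
  define K where "K = Q + 2"
  define e' where "e' = (\<lambda>x. 2 * inner (v x) (dv x) + 2 * inner (dv x) (ddv x))"
  have e: "(e has_real_derivative e' x) (at x within {0..1})" if "x \<in> {0..1}" for x
  proof -
    have "((\<lambda>x. inner (v x) (v x) + inner (dv x) (dv x)) has_vector_derivative
        (inner (v x) (dv x) + inner (dv x) (v x)) + (inner (dv x) (ddv x) + inner (ddv x) (dv x)))
        (at x within {0..1})"
      by (intro has_vector_derivative_add bounded_bilinear.has_vector_derivative[OF bounded_bilinear_inner] v dv that)
    thus ?thesis
      unfolding has_real_derivative_iff_has_vector_derivative e_def e'_def
      by (simp add: power2_norm_eq_inner inner_commute algebra_simps)
  qed
  have e'_bd: "\<bar>e' x\<bar> \<le> K * e x + F\<^sup>2" if x: "x \<in> {0..1}" for x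
  proof -
    have 1: "\<bar>inner (v x) (dv x)\<bar> \<le> norm (v x) * norm (dv x)"
      by (rule Cauchy_Schwarz_ineq2)
    have "\<bar>inner (dv x) (ddv x)\<bar> \<le> norm (dv x) * norm (ddv x)"
      by (rule Cauchy_Schwarz_ineq2)
    also have "\<dots> \<le> norm (dv x) * (Q * norm (v x) + F)"
      by (intro mult_left_mono bd x) auto
    finally have 2: "\<bar>inner (dv x) (ddv x)\<bar> \<le> Q * (norm (v x) * norm (dv x)) + norm (dv x) * F"
      by (simp add: algebra_simps)
    have 3: "2 * (norm (v x) * norm (dv x)) \<le> e x"
      using sum_squares_bound[of "norm (v x)" "norm (dv x)"] by (simp add: e_def)
    have "(norm (dv x))\<^sup>2 \<le> e x" by (simp add: e_def)
    with sum_squares_bound[of "norm (dv x)" F]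
    have 4: "2 * (norm (dv x) * F) \<le> e x + F\<^sup>2" by linarith
    have 5: "Q * (2 * (norm (v x) * norm (dv x))) \<le> Q * e x"
      using 3 Q by (rule mult_left_mono)
    have 6: "\<bar>e' x\<bar> \<le> 2 * \<bar>inner (v x) (dv x)\<bar> + 2 * \<bar>inner (dv x) (ddv x)\<bar>"
      unfolding e'_def by linarith
    have "K * e x = Q * e x + 2 * e x" by (simp add: K_def distrib_right)
    with 1 2 3 4 5 6 show ?thesis by linarith
  qed
  \<comment> \<open>Integrating factor \<open>exp (- K * x)\<close>; the summand
    \<open>F\<^sup>2 * x\<close> pays for the inhomogeneity because
    \<open>exp (- K * x) \<le> 1\<close>.\<close>
  have d1: "((\<lambda>x. - (e x * exp (- K * x)) + F\<^sup>2 * x) has_real_derivative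
      (- e' x + K * e x) * exp (- K * x) + F\<^sup>2) (at x within {0..1})" if "x \<in> {0..1}" for x
    by (rule derivative_eq_intros e[OF that] refl | simp add: algebra_simps)+
  have K: "K \<ge> 0" using Q by (simp add: K_def)
  show "e x \<le> exp (Q + 2) * (e 0 + F\<^sup>2)" if x: "x \<in> {0..1}"
  proof -
    have nn: "0 \<le> (- e' x + K * e x) * exp (- K * x) + F\<^sup>2" if "x \<in> {0..1}" for x
    proof -
      have "- F\<^sup>2 \<le> - F\<^sup>2 * exp (- K * x)" using that K by (simp add: mult_left_le)
      also have "\<dots> \<le> (- e' x + K * e x) * exp (- K * x)"
        using e'_bd[OF that] by (intro mult_right_mono) auto
      finally show ?thesis by simp
    qed
    have "- (e 0 * exp (- K * 0)) + F\<^sup>2 * 0 \<le> - (e x * exp (- K * x)) + F\<^sup>2 * x"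
      by (rule nonneg_deriv_imp_le_on_interval[OF d1 nn]) (use x in auto)
    hence "e x * exp (- K * x) \<le> e 0 + F\<^sup>2 * x" by simp
    also have "\<dots> \<le> e 0 + F\<^sup>2" using x by (simp add: mult_left_le)
    finally have "e x \<le> exp (K * x) * (e 0 + F\<^sup>2)"
      by (simp add: exp_minus field_simps)
    also have "\<dots> \<le> exp K * (e 0 + F\<^sup>2)"
      using x K by (intro mult_right_mono) (auto simp: e_def mult_left_le)
    finally show ?thesis by (simp add: K_def)
  qed
  show "e 0 \<le> exp (Q + 2) * e 1" if F0: "F = 0"
  proof -
    have d2: "((\<lambda>x. e x * exp (K * x)) has_real_derivative
      (e' x + K * e x) * exp (K * x)) (at x within {0..1})" if "x \<in> {0..1}" for x
      by (rule derivative_eq_intros e[OF that] refl | simp add: algebra_simps)+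
    have nn: "0 \<le> (e' x + K * e x) * exp (K * x)" if "x \<in> {0..1}" for x
      using e'_bd[OF that] F0 by simp
    have "e 0 * exp (K * 0) \<le> e 1 * exp (K * 1)"
      by (rule nonneg_deriv_imp_le_on_interval[OF d2 nn]) auto
    thus ?thesis by (simp add: K_def mult.commute)
  qed
qed

section \<open>Solutions with initial data independent of the spectral parameter\<close>

locale sl_family =
  fixes q :: "real \<Rightarrow> real" and \<beta> :: real and y dy :: "real \<Rightarrow> complex \<Rightarrow> complex"
  assumes cont_q: "continuous_on {0..1} q"
    and sol: "\<And>\<mu>. sl_solution q \<mu> (\<lambda>x. y x \<mu>) (\<lambda>x. dy x \<mu>)"
    and y0: "\<And>\<mu>. y 0 \<mu> = complex_of_real (sin \<beta>)"
    and dy0: "\<And>\<mu>. dy 0 \<mu> = complex_of_real (cos \<beta>)"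
begin

definition Q where "Q = (SOME Q. 0 \<le> Q \<and> (\<forall>x\<in>{0..1}. \<bar>q x\<bar> \<le> Q))"

lemma Q_nonneg: "0 \<le> Q" and q_le_Q: "x \<in> {0..1} \<Longrightarrow> \<bar>q x\<bar> \<le> Q"
proof -
  have "bounded (q ` {0..1})"
    by (intro compact_imp_bounded compact_continuous_image cont_q) auto
  then obtain B where "\<forall>x\<in>{0..1}. \<bar>q x\<bar> \<le> B" by (auto simp: bounded_iff)
  hence "0 \<le> \<bar>B\<bar> \<and> (\<forall>x\<in>{0..1}. \<bar>q x\<bar> \<le> \<bar>B\<bar>)" by force
  hence "0 \<le> Q \<and> (\<forall>x\<in>{0..1}. \<bar>q x\<bar> \<le> Q)"
    unfolding Q_def by (rule someI)
  thus "0 \<le> Q" "x \<in> {0..1} \<Longrightarrow> \<bar>q x\<bar> \<le> Q" by auto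
qed

lemma y_deriv: "x \<in> {0..1} \<Longrightarrow> ((\<lambda>x. y x \<mu>) has_vector_derivative dy x \<mu>) (at x within {0..1})"
  and dy_deriv: "x \<in> {0..1} \<Longrightarrow>
    ((\<lambda>x. dy x \<mu>) has_vector_derivative (of_real (q x) - \<mu>) * y x \<mu>) (at x within {0..1})"
proof -
  obtain ddu where d: "\<forall>x\<in>{0..1}. ((\<lambda>x. y x \<mu>) has_vector_derivative dy x \<mu>) (at x within {0..1}) \<and>
        ((\<lambda>x. dy x \<mu>) has_vector_derivative ddu x) (at x within {0..1}) \<and>
        - ddu x + complex_of_real (q x) * y x \<mu> = \<mu> * y x \<mu>"
    using sol[of \<mu>] by (auto simp: sl_solution_def)
  show "x \<in> {0..1} \<Longrightarrow> ((\<lambda>x. y x \<mu>) has_vector_derivative dy x \<mu>) (at x within {0..1})"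
    using d by auto
  assume x: "x \<in> {0..1}"
  have "- ddu x + complex_of_real (q x) * y x \<mu> = \<mu> * y x \<mu>" using d x by blast
  hence eq: "ddu x = (of_real (q x) - \<mu>) * y x \<mu>"
    by (simp add: algebra_simps)
  have "((\<lambda>x. dy x \<mu>) has_vector_derivative ddu x) (at x within {0..1})"
    using d x by blast
  thus "((\<lambda>x. dy x \<mu>) has_vector_derivative (of_real (q x) - \<mu>) * y x \<mu>) (at x within {0..1})"
    by (simp only: eq)
qed

lemma cont_y: "continuous_on {0..1} (\<lambda>x. y x \<mu>)"
  using y_deriv by (meson has_vector_derivative_continuous continuous_on_eq_continuous_within)

text \<open>The factor of the energy estimate for the potential \<open>q - \<mu>\<close>. Being at
  least 1, it bounds its own square root, so norms can be estimated by \<open>growth\<close>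
  itself.\<close>

definition growth :: "complex \<Rightarrow> real" where "growth \<mu> = exp (Q + cmod \<mu> + 2)"

lemma growth_pos: "growth \<mu> > 0" by (simp add: growth_def)

lemma potential_bound:
  assumes "x \<in> {0..1}"
  shows "cmod ((of_real (q x) - \<mu>) * z) \<le> (Q + cmod \<mu>) * cmod z"
proof -
  have "cmod (of_real (q x) - \<mu>) \<le> Q + cmod \<mu>"
    using norm_triangle_ineq4[of "of_real (q x)" \<mu>] q_le_Q[OF assms] by simp
  thus ?thesis by (simp add: norm_mult mult_right_mono)
qed

lemma inhomogeneous_bound:
  assumes v: "\<And>x. x \<in> {0..1} \<Longrightarrow> (v has_vector_derivative dv x) (at x within {0..1})"
    and dv: "\<And>x. x \<in> {0..1} \<Longrightarrow>
        (dv has_vector_derivative (of_real (q x) - \<mu>) * v x + f x) (at x within {0..1})"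
    and v0: "v 0 = 0" "dv 0 = 0"
    and f: "\<And>x. x \<in> {0..1} \<Longrightarrow> cmod (f x) \<le> F"
    and x: "x \<in> {0..1}"
  shows "cmod (v x) \<le> growth \<mu> * F" "cmod (dv x) \<le> growth \<mu> * F"
proof -
  have F: "0 \<le> F" using f[of 0] by (auto intro: order_trans[OF norm_ge_zero])
  have "cmod ((of_real (q x) - \<mu>) * v x + f x) \<le> (Q + cmod \<mu>) * cmod (v x) + F" if "x \<in> {0..1}" for x
    using potential_bound[OF that, of \<mu> "v x"] f[OF that]
      norm_triangle_ineq[of "(of_real (q x) - \<mu>) * v x" "f x"] by linarith
  from second_order_energy_forward[OF v dv this _ F x]
  have "(cmod (v x))\<^sup>2 + (cmod (dv x))\<^sup>2 \<le> growth \<mu> * F\<^sup>2"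
    using Q_nonneg v0 by (simp add: growth_def)
  also have "\<dots> \<le> (growth \<mu> * F)\<^sup>2"
  proof -
    have "1 \<le> growth \<mu>" using Q_nonneg by (simp add: growth_def)
    hence "growth \<mu> \<le> growth \<mu> * growth \<mu>" by (simp add: mult_left_le)
    hence "growth \<mu> * F\<^sup>2 \<le> (growth \<mu> * growth \<mu>) * F\<^sup>2"
      by (rule mult_right_mono) simp
    thus ?thesis by (simp add: power2_eq_square mult_ac)
  qed
  finally have *: "(cmod (v x))\<^sup>2 + (cmod (dv x))\<^sup>2 \<le> (growth \<mu> * F)\<^sup>2" .
  have nn: "0 \<le> growth \<mu> * F" using F growth_pos[of \<mu>] by simp
  show "cmod (v x) \<le> growth \<mu> * F"
    by (rule power2_le_imp_le[OF _ nn]) (use * in \<open>smt (verit) zero_le_power2\<close>)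
  show "cmod (dv x) \<le> growth \<mu> * F"
    by (rule power2_le_imp_le[OF _ nn]) (use * in \<open>smt (verit) zero_le_power2\<close>)
qed

lemma y_bound: "x \<in> {0..1} \<Longrightarrow> cmod (y x \<mu>) \<le> growth \<mu>"
proof -
  assume x: "x \<in> {0..1}"
  have "cmod ((of_real (q x) - \<mu>) * y x \<mu>) \<le> (Q + cmod \<mu>) * cmod (y x \<mu>) + 0" if "x \<in> {0..1}" for x
    using potential_bound[OF that] by simp
  from second_order_energy_forward[OF y_deriv dy_deriv this _ _ x]
  have *: "(cmod (y x \<mu>))\<^sup>2 + (cmod (dy x \<mu>))\<^sup>2 \<le> growth \<mu>"
    using Q_nonneg y0 dy0 by (simp add: growth_def)
  have "1 \<le> growth \<mu>" using Q_nonneg by (simp add: growth_def)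
  hence "growth \<mu> \<le> (growth \<mu>)\<^sup>2" by (simp add: power2_eq_square mult_left_le)
  with * show ?thesis
    by (intro power2_le_imp_le[OF _ order_less_imp_le[OF growth_pos]]) (smt (verit) zero_le_power2)
qed

text \<open>Running the energy estimate from 1 back to 0, zero Cauchy data at 1 would force
  \<open>sin \<beta> = cos \<beta> = 0\<close>.\<close>

lemma y_at_1_nonzero: "y 1 \<mu> \<noteq> 0 \<or> dy 1 \<mu> \<noteq> 0"
proof (rule ccontr)
  assume *: "\<not> ?thesis"
  have "cmod ((of_real (q x) - \<mu>) * y x \<mu>) \<le> (Q + cmod \<mu>) * cmod (y x \<mu>) + 0" if "x \<in> {0..1}" for x
    using potential_bound[OF that] by simp
  from second_order_energy_backward[OF y_deriv dy_deriv this]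
  show False using * Q_nonneg y0 dy0 by simp
qed

text \<open>The difference of two solutions has zero initial data and solves the equation at
  \<open>\<nu>\<close> with forcing term \<open>- (\<nu> - \<mu>) * y x \<mu>\<close>.\<close>

lemma y_lipschitz:
  assumes x: "x \<in> {0..1}"
  shows "cmod (y x \<nu> - y x \<mu>) \<le> growth \<nu> * (cmod (\<nu> - \<mu>) * growth \<mu>)"
proof -
  have d1: "((\<lambda>x. y x \<nu> - y x \<mu>) has_vector_derivative (dy x \<nu> - dy x \<mu>)) (at x within {0..1})"
    if "x \<in> {0..1}" for x
    by (intro has_vector_derivative_diff y_deriv that)
  have d2: "((\<lambda>x. dy x \<nu> - dy x \<mu>) has_vector_derivative
      (of_real (q x) - \<nu>) * (y x \<nu> - y x \<mu>) + (- (\<nu> - \<mu>) * y x \<mu>)) (at x within {0..1})"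
    if "x \<in> {0..1}" for x
  proof -
    have "(of_real (q x) - \<nu>) * (y x \<nu> - y x \<mu>) + (- (\<nu> - \<mu>) * y x \<mu>)
       = (of_real (q x) - \<nu>) * y x \<nu> - (of_real (q x) - \<mu>) * y x \<mu>"
      by (simp add: algebra_simps)
    thus ?thesis using has_vector_derivative_diff[OF dy_deriv[OF that] dy_deriv[OF that]] by simp
  qed
  have bd: "cmod (- (\<nu> - \<mu>) * y x \<mu>) \<le> cmod (\<nu> - \<mu>) * growth \<mu>" if "x \<in> {0..1}" for x
    unfolding norm_mult norm_minus_cancel by (rule mult_left_mono[OF y_bound[OF that] norm_ge_zero])
  show ?thesis
    by (rule inhomogeneous_bound(1)[where v = "\<lambda>x. y x \<nu> - y x \<mu>", OF d1 d2 _ _ bd x])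
      (auto simp: y0 dy0)
qed

end

text \<open>With no formula for the derivative at hand, it is obtained by completeness: a Lipschitz
  difference quotient on the punctured disc extends continuously to the centre. The second part
  keeps the rate of convergence, which is uniform wherever \<open>B\<close> is.\<close>

lemma has_field_derivative_if_Lipschitz_quotient:
  fixes h :: "complex \<Rightarrow> complex"
  defines "D \<equiv> \<lambda>\<mu> z. (h z - h \<mu>) / (z - \<mu>)"
  assumes lip: "\<And>z w. z \<in> cball \<mu> 1 - {\<mu>} \<Longrightarrow> w \<in> cball \<mu> 1 - {\<mu>} \<Longrightarrow>
      cmod (D \<mu> z - D \<mu> w) \<le> B * cmod (z - w)"
  shows "(h has_field_derivative deriv h \<mu>) (at \<mu>)"
    and "z \<in> cball \<mu> 1 - {\<mu>} \<Longrightarrow> cmod (D \<mu> z - deriv h \<mu>) \<le> B * cmod (z - \<mu>)"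
proof -
  let ?X = "cball \<mu> 1 - {\<mu>}"
  have at: "at \<mu> within ?X = at \<mu>"
  proof -
    have "at \<mu> within ?X = at \<mu> within cball \<mu> 1"
      by (simp add: at_within_def)
    also have "\<dots> = at \<mu>"
      by (rule at_within_interior) (simp add: interior_cball)
    finally show ?thesis .
  qed
  have "\<bar>B\<bar>-lipschitz_on ?X (D \<mu>)"
  proof (rule lipschitz_onI)
    fix z w assume "z \<in> ?X" "w \<in> ?X"
    from lip[OF this] have "cmod (D \<mu> z - D \<mu> w) \<le> \<bar>B\<bar> * cmod (z - w)"
      by (smt (verit) mult_right_mono norm_ge_zero)
    thus "dist (D \<mu> z) (D \<mu> w) \<le> \<bar>B\<bar> * dist z w" by (simp add: dist_norm)
  qed simp
  hence "uniformly_continuous_on ?X (D \<mu>)" by (rule lipschitz_on_uniformly_continuous)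
  moreover have "\<mu> \<in> closure ?X"
  proof -
    have "\<mu> islimpt cball \<mu> 1" by (rule interior_limit_point) (simp add: interior_cball)
    thus ?thesis by (simp add: islimpt_in_closure)
  qed
  ultimately obtain l where "(D \<mu> \<longlongrightarrow> l) (at \<mu> within ?X)"
    by (rule uniformly_continuous_on_extension_at_closure)
  hence l: "(D \<mu> \<longlongrightarrow> l) (at \<mu>)" by (simp add: at)
  hence d: "(h has_field_derivative l) (at \<mu>)"
    by (simp add: has_field_derivative_iff D_def)
  hence dl: "deriv h \<mu> = l" by (rule DERIV_imp_deriv)
  show "(h has_field_derivative deriv h \<mu>) (at \<mu>)" using d dl by simp
  show "cmod (D \<mu> z - deriv h \<mu>) \<le> B * cmod (z - \<mu>)" if z: "z \<in> ?X"
  proof (rule tendsto_le)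
    show "((\<lambda>w. cmod (D \<mu> z - D \<mu> w)) \<longlongrightarrow> cmod (D \<mu> z - deriv h \<mu>)) (at \<mu>)"
      unfolding dl by (intro tendsto_intros l)
    show "((\<lambda>w. B * cmod (z - w)) \<longlongrightarrow> B * cmod (z - \<mu>)) (at \<mu>)"
      by (intro tendsto_intros)
    have "\<forall>\<^sub>F w in at \<mu>. w \<in> ?X"
      unfolding eventually_at by (rule exI[of _ 1]) (auto simp: dist_commute)
    thus "\<forall>\<^sub>F w in at \<mu>. cmod (D \<mu> z - D \<mu> w) \<le> B * cmod (z - w)"
      by (rule eventually_mono) (rule lip[OF z])
  qed simp
qed

context sl_family
begin

text \<open>\<open>exp (Q + cmod \<mu> + 3)\<close> bounds \<open>growth\<close> on the unit disc
  around \<open>\<mu>\<close>. Two such factors come from \<open>y_lipschitz\<close>, the factor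
  \<open>growth \<mu>\<close> from solving the inhomogeneous equation at
  \<open>\<mu>\<close>.\<close>

definition quot_lip :: "complex \<Rightarrow> real" where
  "quot_lip \<mu> = growth \<mu> * (exp (Q + cmod \<mu> + 3) * exp (Q + cmod \<mu> + 3))"

lemma quot_lip_nonneg: "0 \<le> quot_lip \<mu>"
  by (simp add: quot_lip_def growth_def)

text \<open>A difference quotient \<open>v\<close> satisfies
  \<open>v'' = (q - \<mu>) * v - y x z\<close> with zero initial data, so the difference of two
  quotients is driven by \<open>y x w - y x z\<close> alone, which is Lipschitz in the
  parameter.\<close>

lemma difference_quotient_Lipschitz:
  assumes x: "x \<in> {0..1}" and z: "z \<in> cball \<mu> 1 - {\<mu>}" and w: "w \<in> cball \<mu> 1 - {\<mu>}"
  shows "cmod ((y x z - y x \<mu>) / (z - \<mu>) - (y x w - y x \<mu>) / (w - \<mu>)) \<le> quot_lip \<mu> * cmod (z - w)"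
    and "cmod ((dy x z - dy x \<mu>) / (z - \<mu>) - (dy x w - dy x \<mu>) / (w - \<mu>)) \<le> quot_lip \<mu> * cmod (z - w)"
proof -
  define G where "G = exp (Q + cmod \<mu> + 3)"
  define v where "v = (\<lambda>z x. (y x z - y x \<mu>) / (z - \<mu>))"
  define dv where "dv = (\<lambda>z x. (dy x z - dy x \<mu>) / (z - \<mu>))"
  have G: "growth z \<le> G" if "z \<in> cball \<mu> 1" for z
  proof -
    have "cmod z \<le> cmod \<mu> + 1"
      using that norm_triangle_ineq3[of z \<mu>] by (simp add: dist_norm norm_minus_commute)
    thus ?thesis by (simp add: growth_def G_def)
  qed
  have v: "(v z has_vector_derivative dv z x) (at x within {0..1})" if "x \<in> {0..1}" for x z
    unfolding v_def dv_def
    by (intro has_vector_derivative_divide has_vector_derivative_diff y_deriv that)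
  have dv: "(dv z has_vector_derivative (of_real (q x) - \<mu>) * v z x - y x z) (at x within {0..1})"
    if "x \<in> {0..1}" "z \<noteq> \<mu>" for x z
  proof -
    have "(dv z has_vector_derivative
        ((of_real (q x) - z) * y x z - (of_real (q x) - \<mu>) * y x \<mu>) / (z - \<mu>)) (at x within {0..1})"
      unfolding dv_def by (intro has_vector_derivative_divide has_vector_derivative_diff dy_deriv that)
    moreover have "((of_real (q x) - z) * y x z - (of_real (q x) - \<mu>) * y x \<mu>) / (z - \<mu>)
        = (of_real (q x) - \<mu>) * v z x - y x z"
      using that(2) by (simp add: v_def field_simps)
    ultimately show ?thesis by simp
  qed
  have d1: "((\<lambda>x. v z x - v w x) has_vector_derivative dv z x - dv w x) (at x within {0..1})"
    if "x \<in> {0..1}" for x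
    by (intro has_vector_derivative_diff v that)
  have d2: "((\<lambda>x. dv z x - dv w x) has_vector_derivative
      (of_real (q x) - \<mu>) * (v z x - v w x) + (y x w - y x z)) (at x within {0..1})"
    if "x \<in> {0..1}" for x
  proof -
    have "((\<lambda>x. dv z x - dv w x) has_vector_derivative
      ((of_real (q x) - \<mu>) * v z x - y x z) - ((of_real (q x) - \<mu>) * v w x - y x w)) (at x within {0..1})"
      using z w by (intro has_vector_derivative_diff dv that) auto
    thus ?thesis by (simp add: algebra_simps)
  qed
  have bd: "cmod (y x w - y x z) \<le> G * (cmod (z - w) * G)" if "x \<in> {0..1}" for x
  proof -
    have "cmod (y x w - y x z) \<le> growth w * (cmod (w - z) * growth z)"
      by (rule y_lipschitz[OF that])
    also have "\<dots> \<le> G * (cmod (w - z) * G)"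
      using z w G by (intro mult_mono order_refl mult_nonneg_nonneg) (auto simp: growth_def G_def)
    finally show ?thesis by (simp add: norm_minus_commute)
  qed
  have init: "v z 0 - v w 0 = 0" "dv z 0 - dv w 0 = 0" by (auto simp: v_def dv_def y0 dy0)
  note * = inhomogeneous_bound[where v = "\<lambda>x. v z x - v w x", OF d1 d2 init bd x]
  show "cmod ((y x z - y x \<mu>) / (z - \<mu>) - (y x w - y x \<mu>) / (w - \<mu>)) \<le> quot_lip \<mu> * cmod (z - w)"
    using *(1) by (simp add: v_def quot_lip_def G_def mult_ac)
  show "cmod ((dy x z - dy x \<mu>) / (z - \<mu>) - (dy x w - dy x \<mu>) / (w - \<mu>)) \<le> quot_lip \<mu> * cmod (z - w)"
    using *(2) by (simp add: dv_def quot_lip_def G_def mult_ac)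
qed

lemma y_has_field_derivative:
  "x \<in> {0..1} \<Longrightarrow> (y x has_field_derivative deriv (y x) \<mu>) (at \<mu>)"
  by (rule has_field_derivative_if_Lipschitz_quotient(1)[OF difference_quotient_Lipschitz(1)])

lemma dy_has_field_derivative:
  "x \<in> {0..1} \<Longrightarrow> (dy x has_field_derivative deriv (dy x) \<mu>) (at \<mu>)"
  by (rule has_field_derivative_if_Lipschitz_quotient(1)[OF difference_quotient_Lipschitz(2)])

lemma y_quotient_bound:
  "x \<in> {0..1} \<Longrightarrow> z \<in> cball \<mu> 1 - {\<mu>} \<Longrightarrow>
    cmod ((y x z - y x \<mu>) / (z - \<mu>) - deriv (y x) \<mu>) \<le> quot_lip \<mu> * cmod (z - \<mu>)"
  by (rule has_field_derivative_if_Lipschitz_quotient(2)[OF difference_quotient_Lipschitz(1)])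

lemma y_holomorphic: "x \<in> {0..1} \<Longrightarrow> y x holomorphic_on A"
  unfolding holomorphic_on_def field_differentiable_def
  using y_has_field_derivative DERIV_subset by blast

lemma dy_holomorphic: "x \<in> {0..1} \<Longrightarrow> dy x holomorphic_on A"
  unfolding holomorphic_on_def field_differentiable_def
  using dy_has_field_derivative DERIV_subset by blast

lemma cont_y_lam: "continuous_on {0..1} (\<lambda>x. deriv (y x) \<mu>)"
proof (rule uniform_limit_theorem)
  show "\<forall>\<^sub>F z in at \<mu>. continuous_on {0..1} (\<lambda>x. (y x z - y x \<mu>) / (z - \<mu>))"
    by (intro always_eventually allI)
       (auto simp: divide_inverse intro!: continuous_intros cont_y)
  show "uniform_limit {0..1} (\<lambda>z x. (y x z - y x \<mu>) / (z - \<mu>)) (\<lambda>x. deriv (y x) \<mu>) (at \<mu>)"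
  proof (rule uniform_limitI)
    fix e :: real assume e: "e > 0"
    have "((\<lambda>z. quot_lip \<mu> * cmod (z - \<mu>)) \<longlongrightarrow> quot_lip \<mu> * cmod (\<mu> - \<mu>)) (at \<mu>)"
      by (intro tendsto_intros)
    hence "\<forall>\<^sub>F z in at \<mu>. quot_lip \<mu> * cmod (z - \<mu>) < e"
      using e by (intro order_tendstoD) auto
    moreover have "\<forall>\<^sub>F z in at \<mu>. z \<in> cball \<mu> 1 - {\<mu>}"
      unfolding eventually_at by (rule exI[of _ 1]) (auto simp: dist_commute)
    ultimately show "\<forall>\<^sub>F z in at \<mu>. \<forall>x\<in>{0..1}. dist ((y x z - y x \<mu>) / (z - \<mu>)) (deriv (y x) \<mu>) < e"
      by eventually_elim (use y_quotient_bound in \<open>fastforce simp: dist_norm\<close>)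
  qed
qed simp

text \<open>Bilinear, without complex conjugation: this makes it holomorphic in \<open>\<mu>\<close>
  and symmetric when \<open>f\<close> is itself a solution of the family.\<close>

definition pairing :: "(real \<Rightarrow> complex) \<Rightarrow> complex \<Rightarrow> complex" where
  "pairing f \<mu> = integral {0..1} (\<lambda>x. y x \<mu> * f x)"

text \<open>The error of the difference quotient of \<open>y\<close> is uniform in \<open>x\<close>,
  so boundedness of \<open>f\<close> justifies differentiation under the integral.\<close>

lemma pairing_has_field_derivative:
  assumes f: "continuous_on {0..1} f"
  shows "(pairing f has_field_derivative integral {0..1} (\<lambda>x. deriv (y x) \<mu> * f x)) (at \<mu>)"
proof -
  let ?d = "integral {0..1} (\<lambda>x. deriv (y x) \<mu> * f x)"
  have "bounded (f ` {0..1})"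
    by (intro compact_imp_bounded compact_continuous_image f) auto
  then obtain B where B: "\<And>x. x \<in> {0..1} \<Longrightarrow> cmod (f x) \<le> B"
    unfolding bounded_iff by blast
  have "((\<lambda>z. (pairing f z - pairing f \<mu>) / (z - \<mu>) - ?d) \<longlongrightarrow> 0) (at \<mu>)"
  proof (rule Lim_null_comparison)
    have "\<forall>\<^sub>F z in at \<mu>. z \<in> cball \<mu> 1 - {\<mu>}"
      unfolding eventually_at by (rule exI[of _ 1]) (auto simp: dist_commute)
    thus "\<forall>\<^sub>F z in at \<mu>. norm ((pairing f z - pairing f \<mu>) / (z - \<mu>) - ?d) \<le> quot_lip \<mu> * cmod (z - \<mu>) * B"
    proof eventually_elim
      fix z assume z: "z \<in> cball \<mu> 1 - {\<mu>}"
      let ?g = "\<lambda>x. ((y x z - y x \<mu>) / (z - \<mu>) - deriv (y x) \<mu>) * f x"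
      have i1: "(\<lambda>x. y x z * f x) integrable_on {0..1}" for z
        by (intro integrable_continuous_interval continuous_intros cont_y f)
      have i2: "(\<lambda>x. deriv (y x) \<mu> * f x) integrable_on {0..1}"
        by (intro integrable_continuous_interval continuous_intros cont_y_lam f)
      have "((\<lambda>x. (y x z * f x - y x \<mu> * f x) / (z - \<mu>) - deriv (y x) \<mu> * f x) has_integral
          (pairing f z - pairing f \<mu>) / (z - \<mu>) - ?d) {0..1}"
        unfolding pairing_def
        by (intro has_integral_diff has_integral_divide integrable_integral i1 i2)
      hence eq: "(?g has_integral (pairing f z - pairing f \<mu>) / (z - \<mu>) - ?d) {0..1}"
        by (rule has_integral_eq[rotated]) (simp add: diff_divide_distrib algebra_simps)
      have "norm ((pairing f z - pairing f \<mu>) / (z - \<mu>) - ?d)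
          \<le> (quot_lip \<mu> * cmod (z - \<mu>) * B) * measure lborel (cbox 0 (1::real))"
      proof (rule has_integral_bound)
        show "(?g has_integral (pairing f z - pairing f \<mu>) / (z - \<mu>) - ?d) (cbox 0 1)"
          using eq by simp
        show "0 \<le> quot_lip \<mu> * cmod (z - \<mu>) * B"
          using B[of 0] quot_lip_nonneg by (intro mult_nonneg_nonneg) (auto intro: order_trans[OF norm_ge_zero])
        fix x :: real assume "x \<in> cbox 0 1"
        hence x: "x \<in> {0..1}" by simp
        show "norm (?g x) \<le> quot_lip \<mu> * cmod (z - \<mu>) * B"
          unfolding norm_mult
          by (intro mult_mono y_quotient_bound x z B mult_nonneg_nonneg quot_lip_nonneg) auto
      qed
      thus "norm ((pairing f z - pairing f \<mu>) / (z - \<mu>) - ?d) \<le> quot_lip \<mu> * cmod (z - \<mu>) * B"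
        by simp
    qed
    have "((\<lambda>z. quot_lip \<mu> * cmod (z - \<mu>) * B) \<longlongrightarrow> quot_lip \<mu> * cmod (\<mu> - \<mu>) * B) (at \<mu>)"
      by (intro tendsto_intros)
    thus "((\<lambda>z. quot_lip \<mu> * cmod (z - \<mu>) * B) \<longlongrightarrow> 0) (at \<mu>)" by simp
  qed
  thus ?thesis by (simp add: has_field_derivative_iff LIM_zero_iff)
qed

text \<open>The Wronskian of two solutions has derivative \<open>(z - w) * (y x z * y x w)\<close>
  and vanishes at 0, the initial data being the same for all parameters; only the boundary term at 1
  is left.\<close>

lemma lagrange_identity:
  "(z - w) * pairing (\<lambda>x. y x w) z = y 1 z * dy 1 w - dy 1 z * y 1 w"
proof -
  define W where "W = (\<lambda>x. y x z * dy x w - dy x z * y x w)"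
  have "(W has_vector_derivative (z - w) * (y x z * y x w)) (at x within {0..1})"
    if "x \<in> {0..1}" for x
  proof -
    have "(W has_vector_derivative
       (y x z * ((of_real (q x) - w) * y x w) + dy x z * dy x w) -
       (dy x z * dy x w + ((of_real (q x) - z) * y x z) * y x w)) (at x within {0..1})"
      unfolding W_def by (intro has_vector_derivative_diff has_vector_derivative_mult y_deriv dy_deriv that)
    thus ?thesis by (simp add: algebra_simps)
  qed
  hence "((\<lambda>x. (z - w) * (y x z * y x w)) has_integral W 1 - W 0) {0..1}"
    by (intro fundamental_theorem_of_calculus) auto
  hence "integral {0..1} (\<lambda>x. (z - w) * (y x z * y x w)) = W 1 - W 0"
    by (rule integral_unique)
  moreover have "W 0 = 0" by (simp add: W_def y0 dy0)
  ultimately show ?thesis by (simp add: W_def pairing_def)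
qed

end

section \<open>Minimality in the non-critical case\<close>

lemma
  assumes f: "continuous_on {0..1} f"
  shows continuous_in_L2_01: "f \<in> L2_01"
    and L2_norm_continuous: "L2_norm f = sqrt (integral {0..1} (\<lambda>x. (cmod (f x))\<^sup>2))"
proof -
  have f2: "continuous_on {0..1} (\<lambda>x. (cmod (f x))\<^sup>2)"
    by (intro continuous_intros f)
  have "(\<lambda>x. (cmod (f x))\<^sup>2) absolutely_integrable_on {0..1}"
    by (rule absolutely_integrable_continuous_real[OF f2])
  hence "(\<lambda>x. (cmod (f x))\<^sup>2) absolutely_integrable_on {0<..<1}"
    by (rule set_integrable_subset) auto
  hence int: "integrable (lebesgue_on {0<..<1}) (\<lambda>x. (cmod (f x))\<^sup>2)"
    by (rule absolutely_integrable_imp_integrable) simp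
  moreover have "f \<in> borel_measurable (lebesgue_on {0<..<1})"
    by (rule continuous_imp_measurable_on_sets_lebesgue)
       (auto intro: continuous_on_subset[OF f])
  ultimately show "f \<in> L2_01" by (simp add: L2_01_def)
  show "L2_norm f = sqrt (integral {0..1} (\<lambda>x. (cmod (f x))\<^sup>2))"
    unfolding L2_norm_def by (subst lebesgue_integral_eq_integral[OF int])
      (auto simp: integral_open_interval_real)
qed

text \<open>In place of the Cauchy-Schwarz inequality,
  \<open>2 * e * cmod (f x) \<le> (cmod (f x))\<^sup>2 + e\<^sup>2\<close> is integrated; a strictly
  positive upper bound \<open>e\<close> of the norm can then be divided out.\<close>

lemma integral_norm_le_L2_norm:
  assumes f: "continuous_on {0..1} f" and e: "L2_norm f \<le> e" "0 < e"
  shows "integral {0..1} (\<lambda>x. cmod (f x)) \<le> e"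
proof -
  let ?I = "integral {0..1} (\<lambda>x. (cmod (f x))\<^sup>2)"
  have f2: "(\<lambda>x. (cmod (f x))\<^sup>2) integrable_on {0..1}"
    by (intro integrable_continuous_interval continuous_intros f)
  have f1: "(\<lambda>x. cmod (f x)) integrable_on {0..1}"
    by (intro integrable_continuous_interval continuous_intros f)
  have "?I \<le> e\<^sup>2"
    using e by (simp add: L2_norm_continuous[OF f] sqrt_le_D)
  have "2 * e * integral {0..1} (\<lambda>x. cmod (f x)) = integral {0..1} (\<lambda>x. 2 * e * cmod (f x))"
    by simp
  also have "\<dots> \<le> integral {0..1} (\<lambda>x. (cmod (f x))\<^sup>2 + e\<^sup>2)"
  proof (rule integral_le)
    fix x :: real
    show "2 * e * cmod (f x) \<le> (cmod (f x))\<^sup>2 + e\<^sup>2"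
      using sum_squares_bound[of "cmod (f x)" e] by (simp add: mult_ac)
  qed (intro integrable_add f2 integrable_on_const integrable_on_mult_right f1; simp)+
  also have "\<dots> = ?I + e\<^sup>2"
    by (subst Henstock_Kurzweil_Integration.integral_add) (use f2 in auto)
  also have "\<dots> \<le> 2 * e * e" using \<open>?I \<le> e\<^sup>2\<close> by (simp add: power2_eq_square)
  finally show ?thesis using e(2) by simp
qed

text \<open>Integration against the bounded function \<open>f\<close> is continuous in the
  \<open>L2_norm\<close>; it annihilates the span of the other elements, hence its closure, but not
  \<open>F i\<close>.\<close>

lemma L2_minimal_if_biorthogonal:
  assumes cont: "\<And>i. i \<in> I \<Longrightarrow> continuous_on {0..1} (F i)"
    and bi: "\<And>i. i \<in> I \<Longrightarrow> \<exists>f. continuous_on {0..1} f \<and> integral {0..1} (\<lambda>x. F i x * f x) \<noteq> 0 \<and>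
        (\<forall>j\<in>I - {i}. integral {0..1} (\<lambda>x. F j x * f x) = 0)"
  shows "L2_minimal F I"
  unfolding L2_minimal_def
proof (intro conjI ballI)
  fix i assume i: "i \<in> I"
  show "F i \<in> L2_01" by (rule continuous_in_L2_01[OF cont[OF i]])
  obtain f where f: "continuous_on {0..1} f" "integral {0..1} (\<lambda>x. F i x * f x) \<noteq> 0"
    and orth: "\<And>j. j \<in> I - {i} \<Longrightarrow> integral {0..1} (\<lambda>x. F j x * f x) = 0"
    using bi[OF i] by blast
  have "bounded (f ` {0..1})"
    by (intro compact_imp_bounded compact_continuous_image f) auto
  then obtain B where B: "B > 0" "\<And>x. x \<in> {0..1} \<Longrightarrow> cmod (f x) \<le> B"
    unfolding bounded_pos by blast
  define s where "s = cmod (integral {0..1} (\<lambda>x. F i x * f x))"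
  have s: "s > 0" using f(2) by (simp add: s_def)
  show "F i \<notin> L2_closed_span F (I - {i})"
  proof
    assume "F i \<in> L2_closed_span F (I - {i})"
    \<comment> \<open>An approximation within \<open>s / (2 * B)\<close> changes the functional by
      at most \<open>s / 2\<close>, whereas its value at \<open>F i\<close> has modulus
      \<open>s\<close>.\<close>
    moreover have "s / (2 * B) > 0" using s B(1) by simp
    ultimately obtain J \<alpha> where J: "finite J" "J \<subseteq> I - {i}"
      and small: "L2_norm (\<lambda>x. F i x - (\<Sum>j\<in>J. \<alpha> j * F j x)) < s / (2 * B)"
      unfolding L2_closed_span_def by blast
    let ?g = "\<lambda>x. F i x - (\<Sum>j\<in>J. \<alpha> j * F j x)"
    have cg: "continuous_on {0..1} ?g"
      by (intro continuous_intros cont i) (use J in auto)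
    have int: "(\<lambda>x. F j x * f x) integrable_on {0..1}" if "j \<in> I" for j
      by (intro integrable_continuous_interval continuous_intros cont f that)
    have "((\<lambda>x. F i x * f x - (\<Sum>j\<in>J. \<alpha> j * (F j x * f x))) has_integral
        integral {0..1} (\<lambda>x. F i x * f x) - (\<Sum>j\<in>J. \<alpha> j * integral {0..1} (\<lambda>x. F j x * f x))) {0..1}"
      by (intro has_integral_diff has_integral_sum J has_integral_mult_right integrable_integral int i)
         (use J in auto)
    moreover have "(\<Sum>j\<in>J. \<alpha> j * integral {0..1} (\<lambda>x. F j x * f x)) = 0"
      using J orth by (intro sum.neutral) auto
    ultimately have "((\<lambda>x. ?g x * f x) has_integral integral {0..1} (\<lambda>x. F i x * f x)) {0..1}"
      by (simp add: left_diff_distrib sum_distrib_right mult.assoc)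
    hence "s = cmod (integral {0..1} (\<lambda>x. ?g x * f x))"
      unfolding s_def by (simp add: integral_unique)
    also have "\<dots> \<le> integral {0..1} (\<lambda>x. cmod (?g x) * B)"
      by (rule integral_norm_bound_integral)
         (auto intro!: integrable_continuous_interval continuous_intros cg f(1) cont i mult_left_mono B
               simp: norm_mult)
    also have "\<dots> = integral {0..1} (\<lambda>x. cmod (?g x)) * B"
      by simp
    also have "\<dots> \<le> s / (2 * B) * B"
      by (intro mult_right_mono integral_norm_le_L2_norm cg) (use small s B in auto)
    also have "\<dots> < s" using s B by simp
    finally show False by simp
  qed
qed

lemma tendsto_at_unique_if_eq:
  fixes f :: "complex \<Rightarrow> complex"
  assumes "isCont f z" "isCont h z" "\<forall>\<^sub>F w in at z. f w = h w"
  shows "f z = h z"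
proof (rule tendsto_unique)
  show "(f \<longlongrightarrow> f z) (at z)" using assms(1) by (simp add: isCont_def)
  have "(h \<longlongrightarrow> h z) (at z)" using assms(2) by (simp add: isCont_def)
  thus "(f \<longlongrightarrow> h z) (at z)" using assms(3) tendsto_cong by fastforce
qed simp

section \<open>The pairing of solutions in terms of \<open>\<omega>\<close> and
  \<open>M\<close>\<close>

locale sl_problem = sl_family q \<beta> y dy
  for q \<beta> y dy +
  fixes a b c d :: real
  assumes det: "a * d - b * c < 0"
begin

abbreviation \<omega> where "\<omega> \<equiv> char_fun a b c d y dy"

text \<open>With \<open>N = b y(1) - d y'(1)\<close> one has \<open>\<omega> = \<lambda> M + N\<close>, and \<open>\<sigma>\<close> is the determinant of the
  change of boundary coordinates from \<open>(y(1), y'(1))\<close> to \<open>(M, N)\<close>.\<close>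

definition M :: "complex \<Rightarrow> complex" where
  "M z = of_real a * y 1 z - of_real c * dy 1 z"

definition \<sigma> :: complex where "\<sigma> = of_real (b * c - a * d)"

lemma sigma_nonzero: "\<sigma> \<noteq> 0"
  using det by (auto simp: \<sigma>_def simp del: of_real_diff of_real_mult)

lemma omega_holomorphic: "\<omega> holomorphic_on A"
  unfolding char_fun_def
  by (intro holomorphic_intros y_holomorphic dy_holomorphic) auto

lemma M_holomorphic: "M holomorphic_on A"
  unfolding M_def by (intro holomorphic_intros y_holomorphic dy_holomorphic) auto

lemma omega_has_field_derivative: "(\<omega> has_field_derivative deriv \<omega> z) (at z)"
  using omega_holomorphic[of UNIV] by (simp add: holomorphic_derivI)

lemma M_has_field_derivative: "(M has_field_derivative deriv M z) (at z)"
  using M_holomorphic[of UNIV] by (simp add: holomorphic_derivI)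

text \<open>In the coordinates \<open>(M, N)\<close> the boundary term of Lagrange's identity, times
  \<open>\<sigma>\<close>, is \<open>M z * N w - M w * N z\<close>. Substituting
  \<open>N = \<omega> - \<lambda> M\<close> produces the extra term
  \<open>(z - w) * M z * M w\<close>.\<close>

lemma pairing_identity:
  "(z - w) * (\<sigma> * pairing (\<lambda>x. y x w) z - M z * M w) = M z * \<omega> w - M w * \<omega> z"
proof -
  have "(z - w) * (\<sigma> * pairing (\<lambda>x. y x w) z) = \<sigma> * (y 1 z * dy 1 w - dy 1 z * y 1 w)"
    using lagrange_identity[of z w] by (simp add: mult.left_commute)
  thus ?thesis by (simp add: M_def char_fun_def \<sigma>_def algebra_simps)
qed

lemma omega_eq: "\<omega> z = z * M z + (of_real b * y 1 z - of_real d * dy 1 z)"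
  by (simp add: char_fun_def M_def algebra_simps)

text \<open>If \<open>\<omega>\<close> and \<open>M\<close> vanish, so does \<open>N\<close>; as
  \<open>\<sigma> \<noteq> 0\<close>, the change of coordinates is invertible, and the Cauchy data
  at 1 would be zero.\<close>

lemma M_nonzero: "\<omega> z = 0 \<Longrightarrow> M z \<noteq> 0"
proof
  assume "\<omega> z = 0" "M z = 0"
  hence "of_real b * y 1 z - of_real d * dy 1 z = 0"
    using omega_eq[of z] by simp
  hence n: "of_real b * y 1 z = of_real d * dy 1 z" and m: "of_real a * y 1 z = of_real c * dy 1 z"
    using \<open>M z = 0\<close> by (auto simp: M_def)
  have "\<sigma> * y 1 z = of_real c * (of_real b * y 1 z) - of_real d * (of_real a * y 1 z)"
    by (simp add: \<sigma>_def algebra_simps)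
  also have "\<dots> = 0" unfolding n m by (simp add: algebra_simps)
  finally have "y 1 z = 0" using sigma_nonzero by simp
  have "\<sigma> * dy 1 z = of_real b * (of_real c * dy 1 z) - of_real a * (of_real d * dy 1 z)"
    by (simp add: \<sigma>_def algebra_simps)
  also have "\<dots> = 0" unfolding n[symmetric] m[symmetric] by (simp add: algebra_simps)
  finally have "dy 1 z = 0" using sigma_nonzero by simp
  with \<open>y 1 z = 0\<close> y_at_1_nonzero show False by blast
qed

text \<open>At another zero \<open>z\<close> the quotient drops out and \<open>M z * M w\<close>
  remains, the rank one structure. Keeping \<open>z\<close> free allows limits and derivatives at
  zeros.\<close>

lemma pairing_y_zero:
  assumes "\<omega> w = 0" "z \<noteq> w"
  shows "\<sigma> * pairing (\<lambda>x. y x w) z = M z * M w - M w * (\<omega> z / (z - w))"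
  using pairing_identity[of z w] assms by (simp add: field_simps)

lemma pairing_isCont: "continuous_on {0..1} f \<Longrightarrow> isCont (pairing f) z"
  using pairing_has_field_derivative DERIV_isCont by blast

lemma pairing_DERIV_deriv:
  "continuous_on {0..1} f \<Longrightarrow> (pairing f has_field_derivative deriv (pairing f) z) (at z)"
  using pairing_has_field_derivative DERIV_deriv_iff_field_differentiable field_differentiable_def by blast

lemma pairing_y_zero_diagonal:
  assumes "\<omega> w = 0"
  shows "\<sigma> * pairing (\<lambda>x. y x w) w = M w * (M w - deriv \<omega> w)"
proof (rule tendsto_unique)
  show "((\<lambda>z. \<sigma> * pairing (\<lambda>x. y x w) z) \<longlongrightarrow> \<sigma> * pairing (\<lambda>x. y x w) w) (at w)"
    using pairing_isCont[OF cont_y, of w w] by (intro tendsto_intros) (simp add: isCont_def)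
  have "((\<lambda>z. M z * M w - M w * ((\<omega> z - \<omega> w) / (z - w))) \<longlongrightarrow> M w * M w - M w * deriv \<omega> w) (at w)"
    using omega_has_field_derivative[of w] DERIV_isCont[OF M_has_field_derivative[of w]]
    by (intro tendsto_intros) (auto simp: has_field_derivative_iff isCont_def)
  moreover have "\<forall>\<^sub>F z in at w. \<sigma> * pairing (\<lambda>x. y x w) z = M z * M w - M w * ((\<omega> z - \<omega> w) / (z - w))"
    unfolding eventually_at by (rule exI[of _ 1]) (auto simp: pairing_y_zero assms)
  ultimately show "((\<lambda>z. \<sigma> * pairing (\<lambda>x. y x w) z) \<longlongrightarrow> M w * (M w - deriv \<omega> w)) (at w)"
    by (simp add: tendsto_cong right_diff_distrib)
qed simp

text \<open>By symmetry the \<open>\<lambda>\<close>-derivative of \<open>y\<close> at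
  \<open>w\<close> can be obtained by differentiating \<open>pairing (\<lambda>x. y x z)\<close> at
  \<open>w\<close>; the double zero removes the terms with \<open>\<omega> w\<close> and
  \<open>deriv \<omega> w\<close>.\<close>

lemma pairing_y_lam_zero:
  assumes w: "\<omega> w = 0" "deriv \<omega> w = 0" and z: "z \<noteq> w"
  shows "\<sigma> * pairing (\<lambda>x. deriv (y x) w) z
    = M z * deriv M w - deriv M w * (\<omega> z / (z - w)) - M w * (\<omega> z / (z - w)\<^sup>2)"
proof (rule DERIV_unique)
  have "((\<lambda>u. \<sigma> * pairing (\<lambda>x. y x z) u) has_field_derivative
      \<sigma> * integral {0..1} (\<lambda>x. deriv (y x) w * y x z)) (at w)"
    by (intro DERIV_cmult pairing_has_field_derivative cont_y)
  thus "((\<lambda>u. \<sigma> * pairing (\<lambda>x. y x z) u) has_field_derivative \<sigma> * pairing (\<lambda>x. deriv (y x) w) z) (at w)"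
    by (simp add: pairing_def mult.commute)
  have "((\<lambda>u. M z * M u + (M z * \<omega> u - M u * \<omega> z) / (z - u)) has_field_derivative
     M z * deriv M w + ((- deriv M w * \<omega> z) * (z - w) - M w * \<omega> z) / ((z - w) * (z - w))) (at w)"
    using z w
    by (auto intro!: derivative_eq_intros M_has_field_derivative omega_has_field_derivative)
  moreover have "M z * deriv M w + ((- deriv M w * \<omega> z) * h - M w * \<omega> z) / (h * h) =
     M z * deriv M w - deriv M w * (\<omega> z / h) - M w * (\<omega> z / h\<^sup>2)" if "h \<noteq> 0" for h
    using that by (simp add: diff_divide_distrib power2_eq_square)
  ultimately have "((\<lambda>u. M z * M u + (M z * \<omega> u - M u * \<omega> z) / (z - u)) has_field_derivative
     M z * deriv M w - deriv M w * (\<omega> z / (z - w)) - M w * (\<omega> z / (z - w)\<^sup>2)) (at w)"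
    using z right_minus_eq[of z w] by (simp only: simp_thms)
  thus "((\<lambda>u. \<sigma> * pairing (\<lambda>x. y x z) u) has_field_derivative
     M z * deriv M w - deriv M w * (\<omega> z / (z - w)) - M w * (\<omega> z / (z - w)\<^sup>2)) (at w)"
  proof (rule has_field_derivative_transform_within_open)
    show "open (- {z})" "w \<in> - {z}" using z by auto
    fix u assume "u \<in> - {z}"
    thus "M z * M u + (M z * \<omega> u - M u * \<omega> z) / (z - u) = \<sigma> * pairing (\<lambda>x. y x z) u"
      using pairing_identity[of u z] by (simp add: field_simps)
  qed
qed

text \<open>Since both \<open>\<omega>\<close> and its derivative vanish at \<open>z\<close>, the
  quotient \<open>\<omega> u / (u - w)\<close> has zero derivative there, and only the product of
  the \<open>M\<close> values contributes.\<close>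

lemma pairing_y_zero_deriv:
  assumes w: "\<omega> w = 0" and z: "\<omega> z = 0" "deriv \<omega> z = 0" "z \<noteq> w"
  shows "\<sigma> * deriv (pairing (\<lambda>x. y x w)) z = M w * deriv M z"
proof (rule DERIV_unique)
  show "((\<lambda>u. \<sigma> * pairing (\<lambda>x. y x w) u) has_field_derivative \<sigma> * deriv (pairing (\<lambda>x. y x w)) z) (at z)"
    by (intro DERIV_cmult pairing_DERIV_deriv cont_y)
  have "((\<lambda>u. M u * M w - M w * (\<omega> u / (u - w))) has_field_derivative M w * deriv M z) (at z)"
    using z
    by (auto intro!: derivative_eq_intros M_has_field_derivative omega_has_field_derivative)
  thus "((\<lambda>u. \<sigma> * pairing (\<lambda>x. y x w) u) has_field_derivative M w * deriv M z) (at z)"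
    by (rule has_field_derivative_transform_within_open[where S = "- {w}"])
       (use z w in \<open>auto simp: pairing_y_zero\<close>)
qed

end

section \<open>The biorthogonal system around a double eigenvalue\<close>

text \<open>At the double eigenvalue, \<open>g = \<omega>'' / 2\<close> and \<open>g' = \<omega>''' / 6\<close>.\<close>

locale sl_double = sl_problem q \<beta> y dy a b c d
  for q \<beta> y dy a b c d +
  fixes lam :: "nat \<Rightarrow> complex" and k :: nat and C :: real and g :: "complex \<Rightarrow> complex" and r :: real
  assumes omega_zero_iff: "\<And>z. \<omega> z = 0 \<longleftrightarrow> z \<in> range lam"
    and lam_double: "lam (Suc k) = lam k"
    and lam_other: "\<And>n. n \<notin> {k, Suc k} \<Longrightarrow> lam n \<noteq> lam k"
    and lam_inj: "inj_on lam (- {k, Suc k})"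
    and lam_simple: "\<And>n. n \<notin> {k, Suc k} \<Longrightarrow> deriv \<omega> (lam n) \<noteq> 0"
    and r: "0 < r" and g_holo: "g holomorphic_on ball (lam k) r" and g_nonzero: "g (lam k) \<noteq> 0"
    and omega_g: "\<And>z. z \<in> ball (lam k) r \<Longrightarrow> \<omega> z = (z - lam k)\<^sup>2 * g z"
begin

abbreviation \<kappa> where "\<kappa> \<equiv> lam k"

lemma omega_lam: "\<omega> (lam n) = 0"
  by (simp add: omega_zero_iff)

lemma g_has_field_derivative: "(g has_field_derivative deriv g \<kappa>) (at \<kappa>)"
  using g_holo r by (simp add: holomorphic_derivI)

lemma deriv_omega_double: "deriv \<omega> \<kappa> = 0"
proof (rule DERIV_imp_deriv)
  have "((\<lambda>z. (z - \<kappa>)\<^sup>2 * g z) has_field_derivative 0) (at \<kappa>)"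
    by (auto intro!: derivative_eq_intros g_has_field_derivative)
  thus "(\<omega> has_field_derivative 0) (at \<kappa>)"
    by (rule has_field_derivative_transform_within_open[where S = "ball \<kappa> r"])
       (use r omega_g in auto)
qed

lemma eventually_ball: "\<forall>\<^sub>F z in at \<kappa>. z \<in> ball \<kappa> r - {\<kappa>}"
  unfolding eventually_at by (rule exI[of _ r]) (use r in \<open>auto simp: dist_commute\<close>)

lemma omega_quotient:
  assumes "z \<in> ball \<kappa> r - {\<kappa>}"
  shows "\<omega> z / (z - \<kappa>) = (z - \<kappa>) * g z" "\<omega> z / (z - \<kappa>)\<^sup>2 = g z"
  using omega_g[of z] assms by (auto simp: power2_eq_square)

lemma pairing_double_deriv:
  "\<sigma> * deriv (pairing (\<lambda>x. y x \<kappa>)) \<kappa> = M \<kappa> * (deriv M \<kappa> - g \<kappa>)"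
proof (rule DERIV_unique)
  show "((\<lambda>u. \<sigma> * pairing (\<lambda>x. y x \<kappa>) u) has_field_derivative \<sigma> * deriv (pairing (\<lambda>x. y x \<kappa>)) \<kappa>) (at \<kappa>)"
    by (intro DERIV_cmult pairing_DERIV_deriv cont_y)
  have "((\<lambda>z. M z * M \<kappa> - M \<kappa> * ((z - \<kappa>) * g z)) has_field_derivative M \<kappa> * (deriv M \<kappa> - g \<kappa>)) (at \<kappa>)"
    by (auto intro!: derivative_eq_intros M_has_field_derivative g_has_field_derivative simp: algebra_simps)
  thus "((\<lambda>u. \<sigma> * pairing (\<lambda>x. y x \<kappa>) u) has_field_derivative M \<kappa> * (deriv M \<kappa> - g \<kappa>)) (at \<kappa>)"
  proof (rule has_field_derivative_transform_within_open)
    fix z assume z: "z \<in> ball \<kappa> r"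
    show "M z * M \<kappa> - M \<kappa> * ((z - \<kappa>) * g z) = \<sigma> * pairing (\<lambda>x. y x \<kappa>) z"
    proof (cases "z = \<kappa>")
      case True
      thus ?thesis using pairing_y_zero_diagonal[OF omega_lam, of k] deriv_omega_double by simp
    next
      case False
      hence "\<omega> z / (z - \<kappa>) = (z - \<kappa>) * g z" using omega_quotient(1)[of z] z by blast
      thus ?thesis by (simp only: pairing_y_zero[OF omega_lam False])
    qed
  qed (use r in auto)
qed

text \<open>The formula \<open>pairing_y_lam_zero\<close> holds away from \<open>\<kappa>\<close>
  only. There \<open>\<omega> z / (z - \<kappa>)\<^sup>2\<close> is \<open>g z\<close>, which is
  analytic at \<open>\<kappa>\<close>, so value and derivative at \<open>\<kappa>\<close> follow by
  continuation.\<close>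

lemma
  shows pairing_lam_double: "\<sigma> * pairing (\<lambda>x. deriv (y x) \<kappa>) \<kappa> = M \<kappa> * deriv M \<kappa> - M \<kappa> * g \<kappa>"
    and pairing_lam_double_deriv: "\<sigma> * deriv (pairing (\<lambda>x. deriv (y x) \<kappa>)) \<kappa>
      = deriv M \<kappa> * deriv M \<kappa> - deriv M \<kappa> * g \<kappa> - M \<kappa> * deriv g \<kappa>"
proof -
  let ?P = "\<lambda>z. \<sigma> * pairing (\<lambda>x. deriv (y x) \<kappa>) z"
  let ?R = "\<lambda>z. M z * deriv M \<kappa> - deriv M \<kappa> * ((z - \<kappa>) * g z) - M \<kappa> * g z"
  have P: "(?P has_field_derivative \<sigma> * deriv (pairing (\<lambda>x. deriv (y x) \<kappa>)) \<kappa>) (at \<kappa>)"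
    by (intro DERIV_cmult pairing_DERIV_deriv cont_y_lam)
  have R: "(?R has_field_derivative deriv M \<kappa> * deriv M \<kappa> - deriv M \<kappa> * g \<kappa> - M \<kappa> * deriv g \<kappa>) (at \<kappa>)"
    by (auto intro!: derivative_eq_intros M_has_field_derivative g_has_field_derivative simp: algebra_simps)
  have eq: "?P z = ?R z" if "z \<in> ball \<kappa> r - {\<kappa>}" for z
    using pairing_y_lam_zero[OF omega_lam deriv_omega_double, of z] omega_quotient[OF that] that by simp
  have eqk: "?P \<kappa> = ?R \<kappa>"
    by (rule tendsto_at_unique_if_eq[OF DERIV_isCont[OF P] DERIV_isCont[OF R]])
       (rule eventually_mono[OF eventually_ball eq])
  thus "?P \<kappa> = M \<kappa> * deriv M \<kappa> - M \<kappa> * g \<kappa>" by simp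
  have "(?P has_field_derivative deriv M \<kappa> * deriv M \<kappa> - deriv M \<kappa> * g \<kappa> - M \<kappa> * deriv g \<kappa>) (at \<kappa>)"
    by (rule has_field_derivative_transform_within_open[OF R, of "ball \<kappa> r"])
       (use r eq eqk in \<open>auto, metis\<close>)
  thus "\<sigma> * deriv (pairing (\<lambda>x. deriv (y x) \<kappa>)) \<kappa>
      = deriv M \<kappa> * deriv M \<kappa> - deriv M \<kappa> * g \<kappa> - M \<kappa> * deriv g \<kappa>"
    using P DERIV_unique by blast
qed

abbreviation F where "F \<equiv> root_system y lam k C"

lemma cont_F: "continuous_on {0..1} (F n)"
  unfolding root_system_def by (auto intro!: continuous_intros cont_y cont_y_lam)

text \<open>The factor \<open>\<sigma>\<close> turns the coordinates of eigenfunctions at distinct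
  eigenvalues into plain products of values of \<open>M\<close>.\<close>

definition coord :: "nat \<Rightarrow> (real \<Rightarrow> complex) \<Rightarrow> complex" where
  "coord n f = \<sigma> * integral {0..1} (\<lambda>x. F n x * f x)"

lemma coord_linear:
  assumes "continuous_on {0..1} f" "continuous_on {0..1} h"
  shows "coord n (\<lambda>x. u * f x + v * h x) = u * coord n f + v * coord n h"
proof -
  have i: "(\<lambda>x. F n x * f x) integrable_on {0..1}" if "continuous_on {0..1} f" for f
    by (intro integrable_continuous_interval continuous_intros cont_F that)
  have "((\<lambda>x. u * (F n x * f x) + v * (F n x * h x)) has_integral
      u * integral {0..1} (\<lambda>x. F n x * f x) + v * integral {0..1} (\<lambda>x. F n x * h x)) {0..1}"
    by (intro has_integral_add has_integral_mult_right integrable_integral i assms)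
  hence "integral {0..1} (\<lambda>x. F n x * (u * f x + v * h x)) =
      u * integral {0..1} (\<lambda>x. F n x * f x) + v * integral {0..1} (\<lambda>x. F n x * h x)"
    by (simp add: integral_unique algebra_simps)
  thus ?thesis by (simp add: coord_def algebra_simps)
qed

lemma coord_simple: "n \<noteq> Suc k \<Longrightarrow> coord n f = \<sigma> * pairing f (lam n)"
  by (simp add: coord_def root_system_def pairing_def)

text \<open>Differentiation under the integral sign turns integration against the
  \<open>\<lambda>\<close>-derivative of \<open>y\<close> into the derivative of the
  pairing.\<close>

lemma coord_associated:
  assumes f: "continuous_on {0..1} f"
  shows "coord (Suc k) f = \<sigma> * deriv (pairing f) \<kappa> + of_real C * (\<sigma> * pairing f \<kappa>)"
proof -
  have "((\<lambda>x. deriv (y x) \<kappa> * f x + of_real C * (y x \<kappa> * f x)) has_integral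
      integral {0..1} (\<lambda>x. deriv (y x) \<kappa> * f x) + of_real C * pairing f \<kappa>) {0..1}"
    unfolding pairing_def
    by (intro has_integral_add has_integral_mult_right integrable_integral
        integrable_continuous_interval continuous_intros cont_y cont_y_lam f)
  hence "integral {0..1} (\<lambda>x. F (Suc k) x * f x) = deriv (pairing f) \<kappa> + of_real C * pairing f \<kappa>"
    using DERIV_imp_deriv[OF pairing_has_field_derivative[OF f, of \<kappa>]]
    by (simp add: integral_unique root_system_def algebra_simps)
  thus ?thesis by (simp add: coord_def algebra_simps)
qed

text \<open>The boundary form \<open>a u(1) - c u'(1)\<close> of the associated function; for index
  \<open>Suc k\<close> it takes the place that \<open>M (lam n)\<close> has for an
  eigenfunction.\<close>

definition T where "T = deriv M \<kappa> + of_real C * M \<kappa>"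

lemma coord_y_double: "n \<notin> {k, Suc k} \<Longrightarrow> coord n (\<lambda>x. y x \<kappa>) = M (lam n) * M \<kappa>"
  using pairing_y_zero[OF omega_lam, of "lam n" k] lam_other[of n]
  by (simp add: coord_simple omega_lam)

lemma coord_y_lam_double: "n \<notin> {k, Suc k} \<Longrightarrow> coord n (\<lambda>x. deriv (y x) \<kappa>) = M (lam n) * deriv M \<kappa>"
  using pairing_y_lam_zero[OF omega_lam deriv_omega_double, of "lam n"] lam_other[of n]
  by (simp add: coord_simple omega_lam)

lemma coord_y_simple:
  assumes "n \<notin> {k, Suc k}" "m \<notin> {k, Suc k}"
  shows "coord n (\<lambda>x. y x (lam m)) =
     M (lam n) * M (lam m) - (if n = m then M (lam n) * deriv \<omega> (lam n) else 0)"
proof (cases "n = m")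
  case True
  thus ?thesis using pairing_y_zero_diagonal[OF omega_lam, of n] assms
    by (simp add: coord_simple right_diff_distrib)
next
  case False
  hence "lam n \<noteq> lam m" using assms inj_onD[OF lam_inj, of n m] by auto
  thus ?thesis using pairing_y_zero[OF omega_lam, of "lam n" m] assms False
    by (simp add: coord_simple omega_lam)
qed

lemma coord_associated_y_double: "coord (Suc k) (\<lambda>x. y x \<kappa>) = M \<kappa> * (T - g \<kappa>)"
  unfolding coord_associated[OF cont_y] pairing_double_deriv pairing_y_zero_diagonal[OF omega_lam] T_def deriv_omega_double
  by (simp add: algebra_simps)

lemma coord_associated_y_lam_double:
  "coord (Suc k) (\<lambda>x. deriv (y x) \<kappa>) = deriv M \<kappa> * T - g \<kappa> * T - M \<kappa> * deriv g \<kappa>"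
  unfolding coord_associated[OF cont_y_lam] pairing_lam_double_deriv pairing_lam_double T_def
  by (simp add: algebra_simps)

lemma coord_associated_y_simple:
  assumes "n \<notin> {k, Suc k}"
  shows "coord (Suc k) (\<lambda>x. y x (lam n)) = M (lam n) * T"
  unfolding coord_associated[OF cont_y] T_def
    pairing_y_zero_deriv[OF omega_lam omega_lam deriv_omega_double lam_other[OF assms, symmetric]]
    pairing_y_zero[OF omega_lam lam_other[OF assms, symmetric]] omega_lam
  by (simp add: algebra_simps)

text \<open>Modulo multiples of \<open>deriv \<omega> (lam n)\<close> every \<open>y(\<cdot>, lam n) / M (lam n)\<close> has the coordinates
  \<open>M (lam j)\<close> and \<open>T\<close>. Some \<open>fs\<close> in the span of \<open>y(\<cdot>, \<kappa>)\<close> and \<open>\<partial>y/\<partial>\<lambda>(\<cdot>, \<kappa>)\<close> has exactly these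
  coordinates if \<open>g' + C g\<close> does not vanish at \<open>\<kappa>\<close>; subtracting it leaves a biorthogonal system.\<close>

lemma minimal_if:
  assumes C: "deriv g \<kappa> + of_real C * g \<kappa> \<noteq> 0"
  shows "L2_minimal F (UNIV - {k})"
proof (rule L2_minimal_if_biorthogonal)
  show "continuous_on {0..1} (F i)" for i by (rule cont_F)
  have Mk: "M (lam n) \<noteq> 0" for n by (rule M_nonzero[OF omega_lam])
  \<comment> \<open>The simple coordinates require
    \<open>\<alpha> * M \<kappa> + \<gamma> * deriv M \<kappa> = 1\<close>. Granted this, the
    coordinate of index \<open>Suc k\<close> is \<open>T - g - \<gamma> * M * (g' + C * g)\<close>
    at \<open>\<kappa>\<close>, and equating it with \<open>T\<close> determines
    \<open>\<gamma>\<close>.\<close>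
  define \<gamma> where "\<gamma> = - g \<kappa> / (M \<kappa> * (deriv g \<kappa> + of_real C * g \<kappa>))"
  define \<alpha> where "\<alpha> = (1 - \<gamma> * deriv M \<kappa>) / M \<kappa>"
  define fs where "fs = (\<lambda>x. \<alpha> * y x \<kappa> + \<gamma> * deriv (y x) \<kappa>)"
  have cfs: "continuous_on {0..1} fs"
    unfolding fs_def by (intro continuous_intros cont_y cont_y_lam)
  have \<alpha>: "\<alpha> * M \<kappa> = 1 - \<gamma> * deriv M \<kappa>" using Mk[of k] by (simp add: \<alpha>_def)
  have \<gamma>: "\<gamma> * (M \<kappa> * (deriv g \<kappa> + of_real C * g \<kappa>)) = - g \<kappa>"
    using Mk[of k] C by (simp add: \<gamma>_def)
  have fs_simple: "coord n fs = M (lam n)" if "n \<notin> {k, Suc k}" for n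
  proof -
    have "coord n fs = M (lam n) * (\<alpha> * M \<kappa> + \<gamma> * deriv M \<kappa>)"
      unfolding fs_def coord_linear[OF cont_y cont_y_lam] coord_y_double[OF that] coord_y_lam_double[OF that]
      by (simp add: algebra_simps)
    thus ?thesis by (simp add: \<alpha>)
  qed
  have fs_assoc: "coord (Suc k) fs = T"
  proof -
    have "coord (Suc k) fs = (\<alpha> * M \<kappa>) * (T - g \<kappa>) + \<gamma> * (deriv M \<kappa> * T - g \<kappa> * T - M \<kappa> * deriv g \<kappa>)"
      unfolding fs_def coord_linear[OF cont_y cont_y_lam] coord_associated_y_double coord_associated_y_lam_double
      by simp
    also have "\<dots> = T - g \<kappa> - \<gamma> * (M \<kappa> * (deriv g \<kappa> + of_real C * g \<kappa>))"
      unfolding \<alpha> by (simp add: T_def algebra_simps)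
    finally show ?thesis by (simp add: \<gamma>)
  qed
  fix i assume i: "i \<in> UNIV - {k}"
  \<comment> \<open>For \<open>i = Suc k\<close> the function \<open>y x (lam i)\<close> is the
    eigenfunction at \<open>\<kappa>\<close>, which is not in the system; its coordinate there
    differs from \<open>M \<kappa> * T\<close> by \<open>- M \<kappa> * g \<kappa>\<close>, and this
    survives as the nonzero diagonal entry.\<close>
  define f where "f = (\<lambda>x. (1 / M (lam i)) * y x (lam i) + (- 1) * fs x)"
  have cf: "continuous_on {0..1} f" unfolding f_def by (intro continuous_intros cont_y cfs)
  have ev: "coord j f = (1 / M (lam i)) * coord j (\<lambda>x. y x (lam i)) - coord j fs" for j
    unfolding f_def coord_linear[OF cont_y cfs] by simp
  have "coord j f = (if j = i then (if i = Suc k then - g \<kappa> else - deriv \<omega> (lam i)) else 0)"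
    if "j \<noteq> k" for j
  proof (cases "i = Suc k")
    case True
    hence li: "lam i = \<kappa>" by (simp add: lam_double)
    show ?thesis
    proof (cases "j = Suc k")
      case True
      thus ?thesis using Mk[of k] \<open>i = Suc k\<close> unfolding ev li fs_assoc by (simp add: coord_associated_y_double fs_assoc)
    next
      case False
      thus ?thesis using Mk[of k] \<open>i = Suc k\<close> that unfolding ev li by (simp add: coord_y_double fs_simple)
    qed
  next
    case False
    hence i': "i \<notin> {k, Suc k}" using i by simp
    show ?thesis
    proof (cases "j = Suc k")
      case True
      thus ?thesis using Mk[of i] False unfolding ev by (simp add: coord_associated_y_simple[OF i'] fs_assoc)
    next
      case False
      thus ?thesis using Mk[of i] i' that unfolding ev
        by (auto simp: coord_y_simple fs_simple field_simps)
    qed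
  qed
  hence "coord j f = 0 \<longleftrightarrow> j \<noteq> i" if "j \<noteq> k" for j
    using that g_nonzero lam_simple[of i] i by simp
  hence int: "integral {0..1} (\<lambda>x. F j x * f x) = 0 \<longleftrightarrow> j \<noteq> i" if "j \<noteq> k" for j
    using that sigma_nonzero by (simp add: coord_def)
  show "\<exists>f. continuous_on {0..1} f \<and> integral {0..1} (\<lambda>x. F i x * f x) \<noteq> 0 \<and>
        (\<forall>j\<in>UNIV - {k} - {i}. integral {0..1} (\<lambda>x. F j x * f x) = 0)"
    using cf i int by (intro exI[of _ f]) auto
qed

end

section \<open>Asymptotics for large spectral parameters\<close>

lemma cmod_sin_le: "cmod (sin z) \<le> exp \<bar>Im z\<bar>"
  and cmod_cos_le: "cmod (cos z) \<le> exp \<bar>Im z\<bar>"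
  using cmod_sin_le_exp[of 1 z] cmod_cos_le_exp[of 1 z] by auto

text \<open>The square of \<open>cmod (sin w)\<close> is
  \<open>(cosh (2 * Im w) - cos (2 * Re w)) / 2\<close>. Far from the real axis \<open>cosh\<close>
  dominates; near it, \<open>2 * \<bar>Re w\<bar>\<close> is close to an odd multiple of
  \<open>pi\<close>, so the cosine is not positive.\<close>

lemma cmod_sin_ge_on_circle:
  assumes "cmod w = (real N + 1/2) * pi"
  shows "exp \<bar>Im w\<bar> / 4 \<le> cmod (sin w)"
proof -
  define t where "t = \<bar>Im w\<bar>"
  have sq: "(cmod (sin w))\<^sup>2 = (exp (2 * t) + exp (- 2 * t) - 2 * cos (2 * Re w)) / 4"
    by (cases "Im w \<ge> 0") (simp_all add: norm_sin_squared t_def exp_minus)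
  have "exp (2 * t) / 4 \<le> exp (2 * t) - 2 * cos (2 * Re w)"
  proof (cases "t \<ge> 1")
    case True
    have "3 \<le> exp (2 * t)" using exp_ge_add_one_self[of "2 * t"] True by linarith
    thus ?thesis using cos_le_one[of "2 * Re w"] by linarith
  next
    case False
    define R where "R = cmod w"
    \<comment> \<open>Twice the gap between the radius and \<open>\<bar>Re w\<bar>\<close>. From
      \<open>\<delta> * (R + \<bar>Re w\<bar>) = 2 * t\<^sup>2 \<le> 2\<close> and
      \<open>R \<ge> pi / 2\<close> one gets \<open>\<delta> \<le> pi / 2\<close>, whence
      \<open>cos (pi - \<delta>) \<le> 0\<close>.\<close>
    define \<delta> where "\<delta> = 2 * R - 2 * \<bar>Re w\<bar>"
    have pi3: "pi > 3" by (rule pi_gt3)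
    have R: "R \<ge> pi / 2" using pi3 by (simp add: R_def assms distrib_right)
    have \<delta>0: "\<delta> \<ge> 0" using abs_Re_le_cmod[of w] by (simp add: \<delta>_def R_def)
    have "\<delta> * (R + \<bar>Re w\<bar>) = 2 * (R\<^sup>2 - (Re w)\<^sup>2)"
      by (simp add: \<delta>_def algebra_simps power2_eq_square)
    also have "\<dots> = 2 * t\<^sup>2" by (simp add: R_def t_def cmod_power2)
    also have "\<dots> \<le> 2" using False by (simp add: t_def abs_square_le_1)
    finally have "\<delta> * (R + \<bar>Re w\<bar>) \<le> 2" .
    moreover have "\<delta> * (pi / 2) \<le> \<delta> * (R + \<bar>Re w\<bar>)"
      using R \<delta>0 by (intro mult_left_mono) auto
    ultimately have "\<delta> * (pi / 2) \<le> 2" by linarith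
    moreover have "2 < (pi / 2) * (pi / 2)"
      using mult_strict_mono[OF pi3 pi3] by simp
    ultimately have "\<delta> * (pi / 2) \<le> (pi / 2) * (pi / 2)" by linarith
    hence \<delta>1: "\<delta> \<le> pi / 2"
      by (rule mult_right_le_imp_le) simp
    have "2 * \<bar>Re w\<bar> = pi - \<delta> + real N * (2 * pi)"
      by (simp add: \<delta>_def R_def assms algebra_simps)
    hence "cos (2 * \<bar>Re w\<bar>) = cos (pi - \<delta> + real N * (2 * pi))"
      by (simp only:)
    also have "\<dots> = - cos \<delta>"
      using cos.plus_of_nat[of "pi - \<delta>" N] by (simp add: cos_diff)
    also have "\<dots> \<le> 0" using \<delta>0 \<delta>1 by (simp add: cos_ge_zero)
    finally have "cos (2 * Re w) \<le> 0" by (cases "Re w \<ge> 0") (simp_all)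
    moreover have "exp (2 * t) / 4 \<le> exp (2 * t)" by simp
    ultimately show ?thesis by linarith
  qed
  hence "exp (2 * t) / 16 \<le> (cmod (sin w))\<^sup>2"
  proof -
    have "u / 16 \<le> (u + v - 2 * w) / 4" if "u / 4 \<le> u - 2 * w" "0 \<le> v" for u v w :: real
      using that by argo
    from this[OF \<open>exp (2 * t) / 4 \<le> exp (2 * t) - 2 * cos (2 * Re w)\<close> exp_ge_zero]
    show ?thesis unfolding sq .
  qed
  moreover have "exp (2 * t) / 16 = (exp t / 4)\<^sup>2" by (simp add: power_divide exp_double)
  ultimately show ?thesis unfolding t_def[symmetric] by (metis norm_ge_zero power2_le_imp_le)
qed

text \<open>At \<open>2 * s\<close> the previous bound concerns \<open>2 * sin s * cos s\<close>; as
  each factor is at most \<open>exp \<bar>Im s\<bar>\<close>, the other must be large. Doubling is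
  the reason for the extra factor 1/2 in the radius.\<close>

lemma cmod_sin_cos_ge_on_circle:
  assumes "cmod s = (real N + 1/2) * pi / 2"
  shows "exp \<bar>Im s\<bar> / 8 \<le> cmod (sin s)" "exp \<bar>Im s\<bar> / 8 \<le> cmod (cos s)"
proof -
  let ?e = "exp \<bar>Im s\<bar>"
  have "exp \<bar>Im (2 * s)\<bar> / 4 \<le> cmod (sin (2 * s))"
    by (rule cmod_sin_ge_on_circle[of _ N]) (simp add: norm_mult assms)
  moreover have "exp \<bar>Im (2 * s)\<bar> = ?e * ?e"
    by (simp add: abs_mult flip: exp_add)
  ultimately have *: "?e * ?e / 8 \<le> cmod (sin s) * cmod (cos s)"
    by (simp add: sin_double norm_mult)
  have "cmod (sin s) * cmod (cos s) \<le> cmod (sin s) * ?e"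
    by (intro mult_left_mono cmod_cos_le) simp
  with * have "?e / 8 * ?e \<le> cmod (sin s) * ?e" by linarith
  thus "?e / 8 \<le> cmod (sin s)" by (rule mult_right_le_imp_le) simp
  have "cmod (sin s) * cmod (cos s) \<le> ?e * cmod (cos s)"
    by (intro mult_right_mono cmod_sin_le) simp
  with * have "?e * (?e / 8) \<le> ?e * cmod (cos s)" by linarith
  thus "?e / 8 \<le> cmod (cos s)" by (rule mult_left_le_imp_le) simp
qed

section \<open>Volterra equations and asymptotics of the boundary values\<close>

context sl_family
begin

lemma
  assumes s: "s \<noteq> 0" and x: "x \<in> {0..1}"
  shows volterra_y: "y x (s\<^sup>2) = cos (s * of_real x) * of_real (sin \<beta>) + sin (s * of_real x) / s * of_real (cos \<beta>)
      + integral {0..x} (\<lambda>t. sin (s * of_real (x - t)) * of_real (q t) * y t (s\<^sup>2)) / s"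
    and volterra_dy: "dy x (s\<^sup>2) = - s * sin (s * of_real x) * of_real (sin \<beta>) + cos (s * of_real x) * of_real (cos \<beta>)
      + integral {0..x} (\<lambda>t. cos (s * of_real (x - t)) * of_real (q t) * y t (s\<^sup>2))"
proof -
  have dcos: "((\<lambda>t. cos (s * of_real (x - t))) has_vector_derivative s * sin (s * of_real (x - t))) (at t within {0..x})" for t
  proof -
    have "((\<lambda>u. cos (s * (of_real x - u))) has_field_derivative s * sin (s * (of_real x - of_real t))) (at (of_real t))"
      by (auto intro!: derivative_eq_intros)
    from has_vector_derivative_real_field[OF this] show ?thesis by simp
  qed
  have dsin: "((\<lambda>t. sin (s * of_real (x - t))) has_vector_derivative - (s * cos (s * of_real (x - t)))) (at t within {0..x})" for t
  proof -
    have "((\<lambda>u. sin (s * (of_real x - u))) has_field_derivative - (s * cos (s * (of_real x - of_real t)))) (at (of_real t))"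
      by (auto intro!: derivative_eq_intros)
    from has_vector_derivative_real_field[OF this] show ?thesis by simp
  qed
  have sub: "{0..x} \<subseteq> {0..1}" using x by auto
  have d1: "((\<lambda>x. y x \<mu>) has_vector_derivative dy t \<mu>) (at t within {0..x})" if "t \<in> {0..x}" for t \<mu>
    using y_deriv[of t] that sub by (meson has_vector_derivative_within_subset subsetD)
  have d2: "((\<lambda>x. dy x \<mu>) has_vector_derivative (of_real (q t) - \<mu>) * y t \<mu>) (at t within {0..x})"
    if "t \<in> {0..x}" for t \<mu>
    using dy_deriv[of t] that sub by (meson has_vector_derivative_within_subset subsetD)
  \<comment> \<open>Variation of constants: at \<open>t = x\<close> the functions \<open>E\<close>
    and \<open>H\<close> are the solution and its derivative, at \<open>t = 0\<close> the free
    evolution of the initial data, and in their \<open>t\<close>-derivatives everything but the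
    \<open>q\<close> term cancels.\<close>
  define E where "E = (\<lambda>t. cos (s * of_real (x - t)) * y t (s\<^sup>2) + sin (s * of_real (x - t)) * dy t (s\<^sup>2) / s)"
  define H where "H = (\<lambda>t. - (s * (sin (s * of_real (x - t)) * y t (s\<^sup>2))) + cos (s * of_real (x - t)) * dy t (s\<^sup>2))"
  have "(E has_vector_derivative sin (s * of_real (x - t)) * of_real (q t) * y t (s\<^sup>2) / s) (at t within {0..x})"
    if "t \<in> {0..x}" for t
  proof -
    have "(E has_vector_derivative
      (cos (s * of_real (x - t)) * dy t (s\<^sup>2) + s * sin (s * of_real (x - t)) * y t (s\<^sup>2)) +
      (sin (s * of_real (x - t)) * ((of_real (q t) - s\<^sup>2) * y t (s\<^sup>2))
        + - (s * cos (s * of_real (x - t))) * dy t (s\<^sup>2)) / s) (at t within {0..x})"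
      unfolding E_def
      by (intro has_vector_derivative_add has_vector_derivative_divide has_vector_derivative_mult dcos dsin d1 d2 that)
    moreover have "(cc * D + s * ss * Y) + (ss * ((qq - s\<^sup>2) * Y) + - (s * cc) * D) / s = ss * qq * Y / s"
      for cc ss D Y qq using s by (simp add: field_simps power2_eq_square)
    ultimately show ?thesis by simp
  qed
  hence "((\<lambda>t. sin (s * of_real (x - t)) * of_real (q t) * y t (s\<^sup>2) / s) has_integral E x - E 0) {0..x}"
    using x by (intro fundamental_theorem_of_calculus) auto
  hence "integral {0..x} (\<lambda>t. sin (s * of_real (x - t)) * of_real (q t) * y t (s\<^sup>2)) / s = E x - E 0"
    by (metis integral_divide integral_unique)
  thus "y x (s\<^sup>2) = cos (s * of_real x) * of_real (sin \<beta>) + sin (s * of_real x) / s * of_real (cos \<beta>)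
      + integral {0..x} (\<lambda>t. sin (s * of_real (x - t)) * of_real (q t) * y t (s\<^sup>2)) / s"
    by (simp add: E_def y0 dy0)
  have "(H has_vector_derivative cos (s * of_real (x - t)) * of_real (q t) * y t (s\<^sup>2)) (at t within {0..x})"
    if "t \<in> {0..x}" for t
  proof -
    have "(H has_vector_derivative
      - (s * (sin (s * of_real (x - t)) * dy t (s\<^sup>2) + - (s * cos (s * of_real (x - t))) * y t (s\<^sup>2))) +
      (cos (s * of_real (x - t)) * ((of_real (q t) - s\<^sup>2) * y t (s\<^sup>2))
        + s * sin (s * of_real (x - t)) * dy t (s\<^sup>2))) (at t within {0..x})"
      unfolding H_def
      by (intro has_vector_derivative_add has_vector_derivative_minus has_vector_derivative_mult_right
          has_vector_derivative_mult dcos dsin d1 d2 that)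
    thus ?thesis by (simp add: algebra_simps power2_eq_square)
  qed
  hence "((\<lambda>t. cos (s * of_real (x - t)) * of_real (q t) * y t (s\<^sup>2)) has_integral H x - H 0) {0..x}"
    using x by (intro fundamental_theorem_of_calculus) auto
  hence "integral {0..x} (\<lambda>t. cos (s * of_real (x - t)) * of_real (q t) * y t (s\<^sup>2)) = H x - H 0"
    by (rule integral_unique)
  thus "dy x (s\<^sup>2) = - s * sin (s * of_real x) * of_real (sin \<beta>) + cos (s * of_real x) * of_real (cos \<beta>)
      + integral {0..x} (\<lambda>t. cos (s * of_real (x - t)) * of_real (q t) * y t (s\<^sup>2))"
    by (simp add: H_def y0 dy0)
qed

text \<open>The exponents \<open>\<tau> * (x - t)\<close> and \<open>\<tau> * t\<close> add up to
  \<open>\<tau> * x\<close>, so a bound with weight \<open>exp (\<tau> * x)\<close> reproduces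
  itself under the Volterra operator. \<open>h\<close> stands for \<open>sin\<close> or
  \<open>cos\<close>.\<close>

lemma volterra_integral_bound:
  assumes x: "x \<in> {0..1}" and \<tau>: "\<tau> = \<bar>Im s\<bar>"
    and y: "\<And>t. t \<in> {0..1} \<Longrightarrow> cmod (y t \<mu>) \<le> m * exp (\<tau> * t)"
    and h: "continuous_on UNIV h" "\<And>z. cmod (h z) \<le> exp \<bar>Im z\<bar>"
  shows "cmod (integral {0..x} (\<lambda>t. h (s * of_real (x - t)) * of_real (q t) * y t \<mu>)) \<le> Q * m * exp (\<tau> * x)"
proof -
  have m: "0 \<le> m" using y[of 0] by (auto intro: order_trans[OF norm_ge_zero])
  have "cmod (integral {0..x} (\<lambda>t. h (s * of_real (x - t)) * of_real (q t) * y t \<mu>)) \<le> Q * m * exp (\<tau> * x) * (x - 0)"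
  proof (rule integral_bound)
    show "continuous_on {0..x} (\<lambda>t. h (s * of_real (x - t)) * of_real (q t) * y t \<mu>)"
      using x by (intro continuous_intros continuous_on_compose2[OF h(1)]
          continuous_on_subset[OF cont_q] continuous_on_subset[OF cont_y]) auto
    fix t assume t: "t \<in> {0..x}"
    hence t1: "t \<in> {0..1}" using x by auto
    have "cmod (h (s * of_real (x - t))) \<le> exp (\<tau> * (x - t))"
      using h(2)[of "s * of_real (x - t)"] t by (simp add: \<tau> abs_mult)
    hence "cmod (h (s * of_real (x - t)) * of_real (q t) * y t \<mu>) \<le> exp (\<tau> * (x - t)) * Q * (m * exp (\<tau> * t))"
      unfolding norm_mult using q_le_Q[OF t1] y[OF t1] Q_nonneg
      by (intro mult_mono mult_nonneg_nonneg) auto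
    also have "\<dots> = Q * m * exp (\<tau> * x)"
      by (simp add: algebra_simps flip: exp_add)
    finally show "cmod (h (s * of_real (x - t)) * of_real (q t) * y t \<mu>) \<le> Q * m * exp (\<tau> * x)" .
  qed (use x in auto)
  also have "\<dots> \<le> Q * m * exp (\<tau> * x)"
    using x m Q_nonneg by (simp add: mult_left_le)
  finally show ?thesis .
qed

text \<open>Bootstrap at a maximum point \<open>x0\<close> of
  \<open>cmod (y x (s\<^sup>2)) * exp (- \<tau> * x)\<close>: the Volterra equation gives
  \<open>m \<le> a0 + Q / cmod s * m\<close>, and \<open>Q / cmod s \<le> 1 / 2\<close> absorbs the
  last term. The explicit \<open>a0\<close> records the gain when
  \<open>sin \<beta> = 0\<close>.\<close>

lemma y_asymptotic_bound:
  assumes s: "1 \<le> cmod s" "2 * Q \<le> cmod s" and x: "x \<in> {0..1}"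
  shows "cmod (y x (s\<^sup>2)) \<le> 2 * (\<bar>sin \<beta>\<bar> + \<bar>cos \<beta>\<bar> / cmod s) * exp (\<bar>Im s\<bar> * x)"
proof -
  define \<tau> where "\<tau> = \<bar>Im s\<bar>"
  define a0 where "a0 = \<bar>sin \<beta>\<bar> + \<bar>cos \<beta>\<bar> / cmod s"
  have s0: "s \<noteq> 0" using s by auto
  let ?f = "\<lambda>x. cmod (y x (s\<^sup>2)) * exp (- \<tau> * x)"
  have "continuous_on {0..1} ?f" by (intro continuous_intros cont_y)
  then obtain x0 where x0: "x0 \<in> {0..1}" and max: "\<And>x. x \<in> {0..1} \<Longrightarrow> ?f x \<le> ?f x0"
    using continuous_attains_sup[of "{0..1::real}" ?f] by auto
  define m where "m = ?f x0"
  have y: "cmod (y t (s\<^sup>2)) \<le> m * exp (\<tau> * t)" if "t \<in> {0..1}" for t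
    using max[OF that] by (simp add: m_def exp_minus field_simps)
  define I where "I = integral {0..x0} (\<lambda>t. sin (s * of_real (x0 - t)) * of_real (q t) * y t (s\<^sup>2))"
  have I: "cmod I \<le> Q * m * exp (\<tau> * x0)" unfolding I_def
    by (rule volterra_integral_bound[OF x0 \<tau>_def y]) (auto intro: continuous_intros cmod_sin_le)
  have Qs: "Q / cmod s \<le> 1 / 2" using s s0 by (simp add: divide_le_eq)
  have m0: "m \<ge> 0" by (simp add: m_def)
  have "\<bar>Im (s * of_real x0)\<bar> = \<tau> * x0" using x0 by (simp add: \<tau>_def abs_mult)
  hence sc: "cmod (cos (s * of_real x0)) \<le> exp (\<tau> * x0)" "cmod (sin (s * of_real x0)) \<le> exp (\<tau> * x0)"
    using cmod_sin_le[of "s * of_real x0"] cmod_cos_le[of "s * of_real x0"] by auto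
  have "cmod (y x0 (s\<^sup>2)) \<le> cmod (cos (s * of_real x0) * of_real (sin \<beta>)) +
      cmod (sin (s * of_real x0) / s * of_real (cos \<beta>)) + cmod (I / s)"
    unfolding volterra_y[OF s0 x0] I_def[symmetric]
    by (meson norm_triangle_ineq order_trans add_right_mono)
  also have "\<dots> \<le> exp (\<tau> * x0) * \<bar>sin \<beta>\<bar> + exp (\<tau> * x0) / cmod s * \<bar>cos \<beta>\<bar> + Q * m * exp (\<tau> * x0) / cmod s"
    unfolding norm_mult norm_divide norm_of_real
    by (intro add_mono mult_right_mono divide_right_mono sc I) auto
  also have "\<dots> = (a0 + Q / cmod s * m) * exp (\<tau> * x0)"
    by (simp add: a0_def field_simps)
  also have "\<dots> \<le> (a0 + 1 / 2 * m) * exp (\<tau> * x0)"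
    using Qs m0 by (intro mult_right_mono add_left_mono) auto
  finally have "m \<le> (a0 + 1 / 2 * m)"
    by (simp add: m_def exp_minus field_simps)
  hence "m \<le> 2 * a0" by simp
  have "cmod (y x (s\<^sup>2)) \<le> m * exp (\<tau> * x)" by (rule y[OF x])
  also have "\<dots> \<le> 2 * a0 * exp (\<tau> * x)"
    using \<open>m \<le> 2 * a0\<close> by (intro mult_right_mono) auto
  finally show ?thesis by (simp add: a0_def \<tau>_def)
qed

lemma
  assumes s: "1 \<le> cmod s" "2 * Q \<le> cmod s"
  defines "a0 \<equiv> \<bar>sin \<beta>\<bar> + \<bar>cos \<beta>\<bar> / cmod s"
  shows y_asymptotic: "cmod (y 1 (s\<^sup>2) - (cos s * of_real (sin \<beta>) + sin s / s * of_real (cos \<beta>)))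
      \<le> 2 * Q * a0 * exp \<bar>Im s\<bar> / cmod s"
    and dy_asymptotic: "cmod (dy 1 (s\<^sup>2) - (- s * sin s * of_real (sin \<beta>) + cos s * of_real (cos \<beta>)))
      \<le> 2 * Q * a0 * exp \<bar>Im s\<bar>"
proof -
  have s0: "s \<noteq> 0" using s by auto
  note b = y_asymptotic_bound[OF s, folded a0_def]
  have one: "1 \<in> {0..1::real}" by simp
  note v = volterra_integral_bound[where s = s, OF one refl b]
  have "cmod (y 1 (s\<^sup>2) - (cos s * of_real (sin \<beta>) + sin s / s * of_real (cos \<beta>)))
    = cmod (integral {0..1} (\<lambda>t. sin (s * of_real (1 - t)) * of_real (q t) * y t (s\<^sup>2))) / cmod s"
    by (subst volterra_y[OF s0 one]) (simp add: norm_divide)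
  also have "\<dots> \<le> (Q * (2 * a0) * exp (\<bar>Im s\<bar> * 1)) / cmod s"
    by (intro divide_right_mono v) (auto intro: continuous_intros cmod_sin_le)
  finally show "cmod (y 1 (s\<^sup>2) - (cos s * of_real (sin \<beta>) + sin s / s * of_real (cos \<beta>)))
      \<le> 2 * Q * a0 * exp \<bar>Im s\<bar> / cmod s" by (simp add: mult_ac)
  have "cmod (dy 1 (s\<^sup>2) - (- s * sin s * of_real (sin \<beta>) + cos s * of_real (cos \<beta>)))
    = cmod (integral {0..1} (\<lambda>t. cos (s * of_real (1 - t)) * of_real (q t) * y t (s\<^sup>2)))"
    by (subst volterra_dy[OF s0 one]) simp
  also have "\<dots> \<le> (Q * (2 * a0) * exp (\<bar>Im s\<bar> * 1))"
    by (intro v) (auto intro: continuous_intros cmod_cos_le)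
  finally show "cmod (dy 1 (s\<^sup>2) - (- s * sin s * of_real (sin \<beta>) + cos s * of_real (cos \<beta>)))
      \<le> 2 * Q * a0 * exp \<bar>Im s\<bar>" by (simp add: mult_ac)
qed

text \<open>Both functions must stay away from 0: one governs the leading term of
  \<open>y(1)\<close> and the other that of \<open>y'(1)\<close>, in an order depending on whether
  \<open>sin \<beta>\<close> vanishes. The 8 is that of
  \<open>cmod_sin_cos_ge_on_circle\<close>.\<close>

definition sin_cos_large :: "complex \<Rightarrow> bool" where
  "sin_cos_large s \<longleftrightarrow> exp \<bar>Im s\<bar> / 8 \<le> cmod (sin s) \<and> exp \<bar>Im s\<bar> / 8 \<le> cmod (cos s)"

text \<open>The scale \<open>\<rho>\<close> is 1 if \<open>sin \<beta> \<noteq> 0\<close> and \<open>1 / \<bar>s\<bar>\<close> otherwise.\<close>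

lemma boundary_values_comparable:
  "\<exists>\<eta> K R. 0 < \<eta> \<and> 0 \<le> K \<and> (\<forall>s. R \<le> cmod s \<and> sin_cos_large s \<longrightarrow>
    (\<exists>\<rho>>0. (\<forall>x\<in>{0..1}. cmod (y x (s\<^sup>2)) \<le> 4 * \<rho> * exp (\<bar>Im s\<bar> * x)) \<and>
      \<eta> * \<rho> * exp \<bar>Im s\<bar> \<le> cmod (y 1 (s\<^sup>2)) \<and>
      \<eta> * \<rho> * cmod s * exp \<bar>Im s\<bar> \<le> cmod (dy 1 (s\<^sup>2)) \<and>
      cmod (dy 1 (s\<^sup>2)) \<le> K * \<rho> * cmod s * exp \<bar>Im s\<bar>))"
proof (cases "sin \<beta> = 0")
  case False
  define S where "S = \<bar>sin \<beta>\<bar>"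
  have S: "S > 0" "S \<le> 1" using False by (auto simp: S_def)
  \<comment> \<open>Beyond this \<open>R\<close> the relative error
    \<open>(1 + 4 * Q) / cmod s\<close> is at most \<open>S / 16\<close>, half of the main term
    \<open>S / 8\<close>; the 1 accounts for the \<open>cos \<beta>\<close> term,
    \<open>4 * Q\<close> for the Volterra remainder.\<close>
  define R where "R = max (max 1 (2 * Q)) (16 * (1 + 4 * Q) / S)"
  show ?thesis
  proof (rule exI[of _ "S / 16"], rule exI[of _ "2 + 4 * Q"], rule exI[of _ R], intro conjI allI impI)
    show "0 < S / 16" "0 \<le> 2 + 4 * Q" using S Q_nonneg by auto
    fix s assume s: "R \<le> cmod s \<and> sin_cos_large s"
    define n e u v where "n = cmod s" and "e = exp \<bar>Im s\<bar>" and "u = cmod (sin s)" and "v = cmod (cos s)"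
    have n: "1 \<le> n" "2 * Q \<le> n" "16 * (1 + 4 * Q) / S \<le> n" using s by (auto simp: n_def R_def)
    have e: "e > 0" by (simp add: e_def)
    have small: "(1 + 4 * Q) / n \<le> S / 16" using n S by (simp add: field_simps)
    have uv: "e / 8 \<le> u" "e / 8 \<le> v" "u \<le> e" "v \<le> e"
      using s cmod_sin_le[of s] cmod_cos_le[of s] by (auto simp: sin_cos_large_def e_def u_def v_def)
    define a0 where "a0 = \<bar>sin \<beta>\<bar> + \<bar>cos \<beta>\<bar> / cmod s"
    have "\<bar>cos \<beta>\<bar> \<le> n" using n(1) abs_cos_le_one[of \<beta>] by linarith
    hence "\<bar>cos \<beta>\<bar> / n \<le> 1" using n(1) by simp
    moreover have "0 \<le> \<bar>cos \<beta>\<bar> / n" using n(1) by simp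
    moreover have "a0 = \<bar>sin \<beta>\<bar> + \<bar>cos \<beta>\<bar> / n" by (simp add: a0_def n_def)
    ultimately have a0: "0 \<le> a0" "a0 \<le> 2" using abs_sin_le_one[of \<beta>] by linarith+
    have bound: "2 * Q * a0 * e \<le> 4 * Q * e"
      using mult_left_mono[OF a0(2), of "2 * Q * e"] Q_nonneg e by (simp add: mult_ac)
    define A B where "A = cos s * of_real (sin \<beta>) + sin s / s * of_real (cos \<beta>)"
      and "B = - s * sin s * of_real (sin \<beta>) + cos s * of_real (cos \<beta>)"
    have "cmod (y 1 (s\<^sup>2) - A) \<le> 2 * Q * a0 * e / n"
      unfolding A_def n_def e_def a0_def by (rule y_asymptotic) (use n in \<open>auto simp: n_def\<close>)
    hence errA: "cmod (y 1 (s\<^sup>2) - A) \<le> 4 * Q * e / n"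
      using divide_right_mono[OF bound, of n] n by linarith
    have "cmod (dy 1 (s\<^sup>2) - B) \<le> 2 * Q * a0 * e"
      unfolding B_def e_def a0_def by (rule dy_asymptotic) (use n in \<open>auto simp: n_def\<close>)
    hence errB: "cmod (dy 1 (s\<^sup>2) - B) \<le> 4 * Q * e"
      using bound by linarith
    have A: "e / 8 * S - e / n \<le> cmod A"
    proof -
      have "u * \<bar>cos \<beta>\<bar> \<le> u" by (intro mult_left_le) (simp_all add: u_def)
      hence "u * \<bar>cos \<beta>\<bar> \<le> e" using uv(3) by linarith
      hence "cmod (sin s / s * of_real (cos \<beta>)) \<le> e / n"
        using n by (simp add: norm_mult norm_divide u_def n_def divide_right_mono)
      moreover have "e / 8 * S \<le> cmod (cos s * of_real (sin \<beta>))"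
        using uv S by (simp add: norm_mult v_def S_def mult_right_mono)
      ultimately show ?thesis unfolding A_def
        using norm_triangle_ineq2[of "cos s * of_real (sin \<beta>)" "- (sin s / s * of_real (cos \<beta>))"] by simp
    qed
    have "v * \<bar>cos \<beta>\<bar> \<le> v" by (intro mult_left_le) (simp_all add: v_def)
    hence vc: "cmod (cos s * of_real (cos \<beta>)) \<le> e"
      using uv(4) by (simp add: norm_mult v_def)
    have B: "n * (e / 8 * S) - e \<le> cmod B"
    proof -
      have "n * (e / 8 * S) \<le> n * (u * S)"
        using uv n S by (intro mult_left_mono mult_right_mono) auto
      also have "\<dots> = cmod (- s * sin s * of_real (sin \<beta>))"
        by (simp add: norm_mult u_def n_def S_def)
      finally have "n * (e / 8 * S) \<le> cmod (- s * sin s * of_real (sin \<beta>))" .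
      thus ?thesis unfolding B_def
        using vc norm_triangle_ineq2[of "- s * sin s * of_real (sin \<beta>)" "- (cos s * of_real (cos \<beta>))"] by simp
    qed
    have B': "cmod B \<le> n * e + e"
    proof -
      have "u * \<bar>sin \<beta>\<bar> \<le> u" by (intro mult_left_le) (simp_all add: u_def)
      hence "u * \<bar>sin \<beta>\<bar> \<le> e" using uv(3) by linarith
      hence "n * (u * \<bar>sin \<beta>\<bar>) \<le> n * e"
        using n by (intro mult_left_mono) auto
      hence "cmod (- s * sin s * of_real (sin \<beta>)) \<le> n * e"
        by (simp add: norm_mult u_def n_def mult.assoc)
      thus ?thesis unfolding B_def
        using vc norm_triangle_ineq[of "- s * sin s * of_real (sin \<beta>)" "cos s * of_real (cos \<beta>)"] by simp
    qed
    have key: "(S / 16) * e \<le> e / 8 * S - e / n - 4 * Q * e / n"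
    proof -
      have "(1 + 4 * Q) / n * e = e / n + 4 * Q * e / n"
        by (simp add: add_divide_distrib distrib_right)
      moreover have "e / 8 * S = 2 * ((S / 16) * e)" by simp
      ultimately show ?thesis using mult_right_mono[OF small, of e] e by linarith
    qed
    show "\<exists>\<rho>>0. (\<forall>x\<in>{0..1}. cmod (y x (s\<^sup>2)) \<le> 4 * \<rho> * exp (\<bar>Im s\<bar> * x)) \<and>
      S / 16 * \<rho> * exp \<bar>Im s\<bar> \<le> cmod (y 1 (s\<^sup>2)) \<and>
      S / 16 * \<rho> * cmod s * exp \<bar>Im s\<bar> \<le> cmod (dy 1 (s\<^sup>2)) \<and>
      cmod (dy 1 (s\<^sup>2)) \<le> (2 + 4 * Q) * \<rho> * cmod s * exp \<bar>Im s\<bar>"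
    proof (intro exI[of _ 1] conjI ballI)
      fix x :: real assume x: "x \<in> {0..1}"
      have "cmod (y x (s\<^sup>2)) \<le> 2 * a0 * exp (\<bar>Im s\<bar> * x)"
        using y_asymptotic_bound[OF _ _ x, of s] n by (simp add: n_def a0_def)
      also have "\<dots> \<le> 4 * 1 * exp (\<bar>Im s\<bar> * x)" using a0 by (intro mult_right_mono) auto
      finally show "cmod (y x (s\<^sup>2)) \<le> 4 * 1 * exp (\<bar>Im s\<bar> * x)" .
    next
      show "S / 16 * 1 * exp \<bar>Im s\<bar> \<le> cmod (y 1 (s\<^sup>2))"
        using key A errA norm_triangle_ineq3[of "y 1 (s\<^sup>2)" A] unfolding e_def[symmetric] by linarith
      have "n * ((S / 16) * e) \<le> n * (e / 8 * S - e / n - 4 * Q * e / n)"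
        using n by (intro mult_left_mono key) auto
      also have "\<dots> = n * (e / 8 * S) - e - 4 * Q * e" using n by (simp add: field_simps)
      finally have "S / 16 * n * e \<le> n * (e / 8 * S) - e - 4 * Q * e" by (simp add: mult_ac)
      hence "S / 16 * n * e \<le> cmod (dy 1 (s\<^sup>2))"
        using B errB norm_triangle_ineq3[of "dy 1 (s\<^sup>2)" B] by linarith
      thus "S / 16 * 1 * cmod s * exp \<bar>Im s\<bar> \<le> cmod (dy 1 (s\<^sup>2))"
        by (simp add: e_def n_def)
      have "e + 4 * Q * e \<le> (1 + 4 * Q) * (n * e)"
        using n e Q_nonneg mult_left_mono[of 1 n "(1 + 4 * Q) * e"] by (simp add: algebra_simps)
      hence "n * e + e + 4 * Q * e \<le> (2 + 4 * Q) * (n * e)" by (simp add: algebra_simps)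
      hence "cmod (dy 1 (s\<^sup>2)) \<le> (2 + 4 * Q) * (n * e)"
        using B' errB norm_triangle_ineq3[of "dy 1 (s\<^sup>2)" B] by linarith
      thus "cmod (dy 1 (s\<^sup>2)) \<le> (2 + 4 * Q) * 1 * cmod s * exp \<bar>Im s\<bar>"
        by (simp add: e_def n_def mult.assoc)
    qed simp
  qed
next
  case True
  hence cb: "\<bar>cos \<beta>\<bar> = 1" by (simp add: sin_zero_abs_cos_one)
  \<comment> \<open>Now \<open>a0 = 1 / cmod s\<close>, so the remainder shrinks along with the main
    term; \<open>cmod s \<ge> 32 * Q\<close> makes its relative size at most 1/16, half of the lower
    bound 1/8.\<close>
  define R where "R = max 1 (32 * Q)"
  show ?thesis
  proof (rule exI[of _ "1 / 16"], rule exI[of _ "2 + 4 * Q"], rule exI[of _ R], intro conjI allI impI)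
    show "0 < 1 / (16::real)" "0 \<le> 2 + 4 * Q" using Q_nonneg by auto
    fix s assume s: "R \<le> cmod s \<and> sin_cos_large s"
    define n e u v where "n = cmod s" and "e = exp \<bar>Im s\<bar>" and "u = cmod (sin s)" and "v = cmod (cos s)"
    have n: "1 \<le> n" "2 * Q \<le> n" "32 * Q \<le> n" using s Q_nonneg by (auto simp: n_def R_def)
    have e: "e > 0" by (simp add: e_def)
    have small: "2 * Q / n \<le> 1 / 16" using n by (simp add: field_simps)
    have uv: "e / 8 \<le> u" "e / 8 \<le> v" "u \<le> e" "v \<le> e"
      using s cmod_sin_le[of s] cmod_cos_le[of s] by (auto simp: sin_cos_large_def e_def u_def v_def)
    have errA: "cmod (y 1 (s\<^sup>2) - sin s / s * of_real (cos \<beta>)) \<le> 2 * Q / n * e / n"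
      using y_asymptotic[of s] n True cb by (simp add: n_def e_def)
    have errB: "cmod (dy 1 (s\<^sup>2) - cos s * of_real (cos \<beta>)) \<le> 2 * Q / n * e"
      using dy_asymptotic[of s] n True cb by (simp add: n_def e_def)
    have small': "2 * Q / n * e \<le> e / 16" using mult_right_mono[OF small, of e] e by simp
    have B: "cmod (cos s * of_real (cos \<beta>)) = v" using cb by (simp add: norm_mult v_def)
    have A: "cmod (sin s / s * of_real (cos \<beta>)) = u / n" using cb by (simp add: norm_mult norm_divide u_def n_def)
    show "\<exists>\<rho>>0. (\<forall>x\<in>{0..1}. cmod (y x (s\<^sup>2)) \<le> 4 * \<rho> * exp (\<bar>Im s\<bar> * x)) \<and>
      1 / 16 * \<rho> * exp \<bar>Im s\<bar> \<le> cmod (y 1 (s\<^sup>2)) \<and>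
      1 / 16 * \<rho> * cmod s * exp \<bar>Im s\<bar> \<le> cmod (dy 1 (s\<^sup>2)) \<and>
      cmod (dy 1 (s\<^sup>2)) \<le> (2 + 4 * Q) * \<rho> * cmod s * exp \<bar>Im s\<bar>"
    proof (intro exI[of _ "1 / n"] conjI ballI)
      show "0 < 1 / n" using n by simp
      fix x :: real assume x: "x \<in> {0..1}"
      have "cmod (y x (s\<^sup>2)) \<le> 2 * (1 / n) * exp (\<bar>Im s\<bar> * x)"
        using y_asymptotic_bound[OF _ _ x, of s] n True cb by (simp add: n_def)
      also have "\<dots> \<le> 4 * (1 / n) * exp (\<bar>Im s\<bar> * x)" using n by (intro mult_right_mono) auto
      finally show "cmod (y x (s\<^sup>2)) \<le> 4 * (1 / n) * exp (\<bar>Im s\<bar> * x)" .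
    next
      have "e / 16 / n \<le> (u - 2 * Q / n * e) / n"
        using n uv small' by (intro divide_right_mono) auto
      hence "e / 16 / n \<le> u / n - 2 * Q / n * e / n" by (simp only: diff_divide_distrib)
      hence "e / 16 / n \<le> cmod (y 1 (s\<^sup>2))"
        using A errA norm_triangle_ineq3[of "y 1 (s\<^sup>2)" "sin s / s * of_real (cos \<beta>)"] by linarith
      thus "1 / 16 * (1 / n) * exp \<bar>Im s\<bar> \<le> cmod (y 1 (s\<^sup>2))"
        unfolding e_def[symmetric] by simp
      have "e / 16 \<le> cmod (dy 1 (s\<^sup>2))"
        using B errB uv small' norm_triangle_ineq3[of "dy 1 (s\<^sup>2)" "cos s * of_real (cos \<beta>)"] by linarith
      thus "1 / 16 * (1 / n) * cmod s * exp \<bar>Im s\<bar> \<le> cmod (dy 1 (s\<^sup>2))"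
        using n unfolding e_def[symmetric] n_def[symmetric] by simp
      have "cmod (dy 1 (s\<^sup>2)) \<le> e + e / 16"
        using B errB uv small' norm_triangle_ineq3[of "dy 1 (s\<^sup>2)" "cos s * of_real (cos \<beta>)"] by linarith
      also have "\<dots> \<le> (2 + 4 * Q) * e" using e Q_nonneg by (simp add: algebra_simps)
      finally show "cmod (dy 1 (s\<^sup>2)) \<le> (2 + 4 * Q) * (1 / n) * cmod s * exp \<bar>Im s\<bar>"
        using n unfolding e_def[symmetric] n_def[symmetric] by simp
    qed
  qed
qed

end

section \<open>Lower bound for \<open>\<omega>\<close> and the quotient \<open>y / \<omega>\<close>
  on large circles\<close>

context sl_problem
begin

text \<open>If \<open>c \<noteq> 0\<close>, the term \<open>c * \<lambda> * y'(1)\<close> of order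
  \<open>(cmod s) ^ 3\<close> dominates. If \<open>c = 0\<close>, then \<open>a \<noteq> 0\<close>
  by the sign condition, and \<open>a * \<lambda> * y(1)\<close> of order
  \<open>(cmod s)\<^sup>2\<close> dominates \<open>d * y'(1)\<close>. One common
  \<open>\<rho>\<close> for \<open>y\<close> and \<open>\<omega>\<close> lets it cancel
  later.\<close>

lemma omega_lower_bound:
  "\<exists>\<eta> R. 0 < \<eta> \<and> 1 \<le> R \<and> (\<forall>s. R \<le> cmod s \<and> sin_cos_large s \<longrightarrow>
    (\<exists>\<rho>>0. (\<forall>x\<in>{0..1}. cmod (y x (s\<^sup>2)) \<le> 4 * \<rho> * exp (\<bar>Im s\<bar> * x)) \<and>
      \<eta> * \<rho> * (cmod s)\<^sup>2 * exp \<bar>Im s\<bar> \<le> cmod (\<omega> (s\<^sup>2))))"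
proof -
  obtain \<eta> K R where \<eta>: "0 < \<eta>" "0 \<le> K" and bv: "\<And>s. R \<le> cmod s \<and> sin_cos_large s \<Longrightarrow>
    (\<exists>\<rho>>0. (\<forall>x\<in>{0..1}. cmod (y x (s\<^sup>2)) \<le> 4 * \<rho> * exp (\<bar>Im s\<bar> * x)) \<and>
      \<eta> * \<rho> * exp \<bar>Im s\<bar> \<le> cmod (y 1 (s\<^sup>2)) \<and>
      \<eta> * \<rho> * cmod s * exp \<bar>Im s\<bar> \<le> cmod (dy 1 (s\<^sup>2)) \<and>
      cmod (dy 1 (s\<^sup>2)) \<le> K * \<rho> * cmod s * exp \<bar>Im s\<bar>)"
    using boundary_values_comparable by blast
  have lin: "\<exists>R0\<ge>1. \<forall>n\<ge>R0. h / 2 * n\<^sup>2 \<le> h * n\<^sup>2 - p" if "h > 0" for h p :: real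
  proof (intro exI[of _ "max 1 (2 * \<bar>p\<bar> / h)"] conjI allI impI)
    fix n assume n: "max 1 (2 * \<bar>p\<bar> / h) \<le> n"
    have "2 * \<bar>p\<bar> \<le> h * n" using n that by (simp add: field_simps)
    also have "\<dots> \<le> h * n\<^sup>2" using n that by (simp add: power2_eq_square)
    finally show "h / 2 * n\<^sup>2 \<le> h * n\<^sup>2 - p" by (simp add: field_simps)
  qed simp
  show ?thesis
  proof (cases "c = 0")
    case False
    obtain R0 where R0: "R0 \<ge> 1" "\<And>n. R0 \<le> n \<Longrightarrow> \<bar>c\<bar> / 2 * n\<^sup>2 \<le> \<bar>c\<bar> * n\<^sup>2 - \<bar>d\<bar>"
      using lin[of "\<bar>c\<bar>"] False by auto
    define p where "p = 4 * (\<bar>a\<bar> + \<bar>b\<bar>)"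
    \<comment> \<open>Makes the \<open>c\<close> term at least \<open>1 + p\<close> times
      \<open>\<rho> * n\<^sup>2 * e\<close>, while the other term is at most \<open>p\<close> times
      it; hence the constant 1 in the bound.\<close>
    define R1 where "R1 = max (max R R0) (2 * (1 + p) / (\<bar>c\<bar> * \<eta>))"
    show ?thesis
    proof (rule exI[of _ 1], rule exI[of _ R1], intro conjI allI impI)
      show "1 \<le> R1" using R0 by (simp add: R1_def)
      fix s assume s: "R1 \<le> cmod s \<and> sin_cos_large s"
      define n e where "n = cmod s" and "e = exp \<bar>Im s\<bar>"
      have n: "R \<le> n" "R0 \<le> n" "1 \<le> n" "2 * (1 + p) / (\<bar>c\<bar> * \<eta>) \<le> n"
        using s R0 by (auto simp: R1_def n_def)
      obtain \<rho> where \<rho>: "\<rho> > 0" and yx: "\<forall>x\<in>{0..1}. cmod (y x (s\<^sup>2)) \<le> 4 * \<rho> * exp (\<bar>Im s\<bar> * x)"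
        and dy1: "\<eta> * \<rho> * n * e \<le> cmod (dy 1 (s\<^sup>2))"
        using bv[of s] s n by (auto simp: n_def e_def)
      have e: "e > 0" by (simp add: e_def)
      have y1: "cmod (y 1 (s\<^sup>2)) \<le> 4 * \<rho> * e" using bspec[OF yx, of 1] by (simp add: e_def)
      have "cmod (of_real a * s\<^sup>2 + of_real b) \<le> \<bar>a\<bar> * n\<^sup>2 + \<bar>b\<bar>"
        using norm_triangle_ineq[of "of_real a * s\<^sup>2" "of_real b"] by (simp add: norm_mult norm_power n_def)
      also have "\<dots> \<le> (\<bar>a\<bar> + \<bar>b\<bar>) * n\<^sup>2"
        using n mult_left_mono[of 1 "n\<^sup>2" "\<bar>b\<bar>"] by (simp add: algebra_simps)
      finally have "cmod ((of_real a * s\<^sup>2 + of_real b) * y 1 (s\<^sup>2)) \<le> (\<bar>a\<bar> + \<bar>b\<bar>) * n\<^sup>2 * (4 * \<rho> * e)"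
        unfolding norm_mult using y1 by (intro mult_mono) auto
      hence 1: "cmod ((of_real a * s\<^sup>2 + of_real b) * y 1 (s\<^sup>2)) \<le> p * (\<rho> * n\<^sup>2 * e)"
        by (simp add: p_def algebra_simps)
      have "\<bar>c\<bar> / 2 * n\<^sup>2 \<le> cmod (of_real c * s\<^sup>2 + of_real d)"
        using R0(2)[OF n(2)] norm_triangle_ineq2[of "of_real c * s\<^sup>2" "- of_real d"]
        by (simp add: norm_mult norm_power n_def)
      hence "\<bar>c\<bar> / 2 * n\<^sup>2 * (\<eta> * \<rho> * n * e) \<le> cmod ((of_real c * s\<^sup>2 + of_real d) * dy 1 (s\<^sup>2))"
        unfolding norm_mult using dy1 n \<eta> \<rho> e by (intro mult_mono) auto
      moreover have "1 + p \<le> \<bar>c\<bar> * \<eta> / 2 * n" using n(4) False \<eta> by (simp add: field_simps)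
      hence "(1 + p) * (\<rho> * n\<^sup>2 * e) \<le> \<bar>c\<bar> * \<eta> / 2 * n * (\<rho> * n\<^sup>2 * e)"
        using \<rho> e by (intro mult_right_mono) auto
      hence "(1 + p) * (\<rho> * n\<^sup>2 * e) \<le> \<bar>c\<bar> / 2 * n\<^sup>2 * (\<eta> * \<rho> * n * e)"
        by (simp add: mult_ac)
      ultimately have 2: "(1 + p) * (\<rho> * n\<^sup>2 * e) \<le> cmod ((of_real c * s\<^sup>2 + of_real d) * dy 1 (s\<^sup>2))"
        by linarith
      have "cmod ((of_real c * s\<^sup>2 + of_real d) * dy 1 (s\<^sup>2)) - cmod ((of_real a * s\<^sup>2 + of_real b) * y 1 (s\<^sup>2))
          \<le> cmod (\<omega> (s\<^sup>2))"
        unfolding char_fun_def by (metis norm_minus_commute norm_triangle_ineq2)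
      with 1 2 have "1 * \<rho> * n\<^sup>2 * e \<le> cmod (\<omega> (s\<^sup>2))" by (simp add: algebra_simps)
      thus "\<exists>\<rho>>0. (\<forall>x\<in>{0..1}. cmod (y x (s\<^sup>2)) \<le> 4 * \<rho> * exp (\<bar>Im s\<bar> * x)) \<and>
        1 * \<rho> * (cmod s)\<^sup>2 * exp \<bar>Im s\<bar> \<le> cmod (\<omega> (s\<^sup>2))"
        using \<rho> yx by (auto simp: n_def e_def)
    qed simp
  next
    case True
    hence a: "a \<noteq> 0" using det by auto
    obtain R0 where R0: "R0 \<ge> 1" "\<And>n. R0 \<le> n \<Longrightarrow> \<bar>a\<bar> / 2 * n\<^sup>2 \<le> \<bar>a\<bar> * n\<^sup>2 - \<bar>b\<bar>"
      using lin[of "\<bar>a\<bar>"] a by auto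
    define h where "h = \<bar>a\<bar> / 2 * \<eta>"
    have h: "h > 0" using a \<eta> by (simp add: h_def)
    define R1 where "R1 = max (max R R0) (2 * (\<bar>d\<bar> * K) / h)"
    show ?thesis
    proof (rule exI[of _ "h / 2"], rule exI[of _ R1], intro conjI allI impI)
      show "0 < h / 2" using h by simp
      show "1 \<le> R1" using R0 by (simp add: R1_def)
      fix s assume s: "R1 \<le> cmod s \<and> sin_cos_large s"
      define n e where "n = cmod s" and "e = exp \<bar>Im s\<bar>"
      have n: "R \<le> n" "R0 \<le> n" "1 \<le> n" "2 * (\<bar>d\<bar> * K) / h \<le> n"
        using s R0 by (auto simp: R1_def n_def)
      obtain \<rho> where \<rho>: "\<rho> > 0" and yx: "\<forall>x\<in>{0..1}. cmod (y x (s\<^sup>2)) \<le> 4 * \<rho> * exp (\<bar>Im s\<bar> * x)"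
        and y1: "\<eta> * \<rho> * e \<le> cmod (y 1 (s\<^sup>2))" and dy1: "cmod (dy 1 (s\<^sup>2)) \<le> K * \<rho> * n * e"
        using bv[of s] s n by (auto simp: n_def e_def)
      have e: "e > 0" by (simp add: e_def)
      have "\<bar>a\<bar> / 2 * n\<^sup>2 \<le> cmod (of_real a * s\<^sup>2 + of_real b)"
        using R0(2)[OF n(2)] norm_triangle_ineq2[of "of_real a * s\<^sup>2" "- of_real b"]
        by (simp add: norm_mult norm_power n_def)
      hence "\<bar>a\<bar> / 2 * n\<^sup>2 * (\<eta> * \<rho> * e) \<le> cmod ((of_real a * s\<^sup>2 + of_real b) * y 1 (s\<^sup>2))"
        unfolding norm_mult using y1 n \<eta> \<rho> e by (intro mult_mono) auto
      hence 1: "h * (\<rho> * n\<^sup>2 * e) \<le> cmod ((of_real a * s\<^sup>2 + of_real b) * y 1 (s\<^sup>2))"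
        by (simp add: h_def mult_ac)
      have "cmod ((of_real c * s\<^sup>2 + of_real d) * dy 1 (s\<^sup>2)) \<le> \<bar>d\<bar> * (K * \<rho> * n * e)"
        unfolding norm_mult using dy1 True by (intro mult_mono) auto
      also have "\<dots> = (\<bar>d\<bar> * K) * (\<rho> * n * e)" by (simp add: mult_ac)
      also have "\<dots> \<le> (h / 2 * n) * (\<rho> * n * e)"
      proof (rule mult_right_mono)
        show "\<bar>d\<bar> * K \<le> h / 2 * n" using n(4) h by (simp add: field_simps)
      qed (use \<rho> n e in auto)
      also have "\<dots> = h / 2 * (\<rho> * n\<^sup>2 * e)" by (simp add: power2_eq_square)
      finally have 2: "cmod ((of_real c * s\<^sup>2 + of_real d) * dy 1 (s\<^sup>2)) \<le> h / 2 * (\<rho> * n\<^sup>2 * e)" .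
      have "cmod ((of_real a * s\<^sup>2 + of_real b) * y 1 (s\<^sup>2)) - cmod ((of_real c * s\<^sup>2 + of_real d) * dy 1 (s\<^sup>2))
          \<le> cmod (\<omega> (s\<^sup>2))"
        unfolding char_fun_def by (rule norm_triangle_ineq2)
      with 1 2 have "h / 2 * (\<rho> * n\<^sup>2 * e) \<le> cmod (\<omega> (s\<^sup>2))" by linarith
      thus "\<exists>\<rho>>0. (\<forall>x\<in>{0..1}. cmod (y x (s\<^sup>2)) \<le> 4 * \<rho> * exp (\<bar>Im s\<bar> * x)) \<and>
        h / 2 * \<rho> * (cmod s)\<^sup>2 * exp \<bar>Im s\<bar> \<le> cmod (\<omega> (s\<^sup>2))"
        using \<rho> yx by (intro exI[of _ \<rho>]) (auto simp: n_def e_def mult.assoc)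
    qed
  qed
qed

text \<open>Moduli of \<open>s\<^sup>2\<close> in the \<open>\<lambda>\<close>-plane for
  \<open>cmod s = (N + 1/2) * pi / 2\<close>, where \<open>sin_cos_large s\<close> holds.\<close>

definition radius :: "nat \<Rightarrow> real" where
  "radius N = ((real N + 1/2) * pi / 2)\<^sup>2"

lemma quotient_bound_on_circles:
  "\<exists>K N0. 0 \<le> K \<and> (\<forall>N\<ge>N0. \<forall>z. cmod z = radius N \<longrightarrow> \<omega> z \<noteq> 0 \<and>
     (\<forall>x\<in>{0..1}. cmod (y x z / \<omega> z) \<le> K * exp (- \<bar>Im (csqrt z)\<bar> * (1 - x)) / radius N))"
proof -
  obtain \<eta> R where \<eta>: "0 < \<eta>" "1 \<le> R" and lb: "\<And>s. R \<le> cmod s \<and> sin_cos_large s \<Longrightarrow>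
    (\<exists>\<rho>>0. (\<forall>x\<in>{0..1}. cmod (y x (s\<^sup>2)) \<le> 4 * \<rho> * exp (\<bar>Im s\<bar> * x)) \<and>
      \<eta> * \<rho> * (cmod s)\<^sup>2 * exp \<bar>Im s\<bar> \<le> cmod (\<omega> (s\<^sup>2)))"
    using omega_lower_bound by blast
  obtain N0 :: nat where N0: "R \<le> real N0" using real_arch_simple by blast
  show ?thesis
  proof (rule exI[of _ "4 / \<eta>"], rule exI[of _ N0], intro conjI allI impI)
    show "0 \<le> 4 / \<eta>" using \<eta> by simp
    fix N z assume N: "N0 \<le> N" and z: "cmod z = radius N"
    define s where "s = csqrt z"
    have s2: "s\<^sup>2 = z" by (simp add: s_def)
    have cs: "cmod s = (real N + 1/2) * pi / 2"
    proof (rule power2_eq_imp_eq)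
      show "(cmod s)\<^sup>2 = ((real N + 1/2) * pi / 2)\<^sup>2"
        using z s2 by (simp flip: norm_power add: radius_def)
    qed auto
    have "real N \<le> real N * (pi / 2)" using pi_gt3 mult_left_mono[of 2 pi "real N"] by simp
    hence "R \<le> cmod s" using N N0 pi_gt3 unfolding cs by (simp add: distrib_right)
    moreover have "sin_cos_large s"
      unfolding sin_cos_large_def using cmod_sin_cos_ge_on_circle[OF cs] by simp
    ultimately obtain \<rho> where \<rho>: "\<rho> > 0" and yx: "\<And>x. x \<in> {0..1} \<Longrightarrow> cmod (y x z) \<le> 4 * \<rho> * exp (\<bar>Im s\<bar> * x)"
      and w: "\<eta> * \<rho> * (cmod s)\<^sup>2 * exp \<bar>Im s\<bar> \<le> cmod (\<omega> z)"
      using lb[of s] unfolding s2 by blast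
    have n2: "(cmod s)\<^sup>2 = radius N" by (simp add: cs radius_def)
    have rp: "radius N > 0" by (simp add: radius_def)
    have pos: "0 < \<eta> * \<rho> * radius N * exp \<bar>Im s\<bar>" using \<eta> \<rho> rp by simp
    with w have "0 < cmod (\<omega> z)" unfolding n2 by (rule less_le_trans[rotated])
    thus "\<omega> z \<noteq> 0" by simp
    show "\<forall>x\<in>{0..1}. cmod (y x z / \<omega> z) \<le> 4 / \<eta> * exp (- \<bar>Im (csqrt z)\<bar> * (1 - x)) / radius N"
    proof
      fix x :: real assume x: "x \<in> {0..1}"
      have "cmod (y x z / \<omega> z) \<le> (4 * \<rho> * exp (\<bar>Im s\<bar> * x)) / (\<eta> * \<rho> * radius N * exp \<bar>Im s\<bar>)"
        unfolding norm_divide using yx[OF x] w pos \<rho> n2 by (intro frac_le) auto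
      also have "\<dots> = 4 / \<eta> * (exp (\<bar>Im s\<bar> * x) / exp \<bar>Im s\<bar>) / radius N"
        using \<rho> by simp
      also have "exp (\<bar>Im s\<bar> * x) / exp \<bar>Im s\<bar> = exp (- \<bar>Im s\<bar> * (1 - x))"
        by (simp add: algebra_simps flip: exp_diff)
      finally show "cmod (y x z / \<omega> z) \<le> 4 / \<eta> * exp (- \<bar>Im (csqrt z)\<bar> * (1 - x)) / radius N"
        by (simp add: s_def)
    qed
  qed
qed

end

section \<open>The residue relation in the critical case\<close>

text \<open>Dividing out the zero leaves the holomorphic \<open>f / h\<close> over a pure power,
  whose residue is a Taylor coefficient. A zero of order \<open>Suc n\<close> goes with the
  \<open>n\<close>-th derivative, so 0 is the simple and 1 the double case.\<close>

lemma residue_quotient_zero_order: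
  fixes f w h :: "complex \<Rightarrow> complex"
  assumes f: "f holomorphic_on ball p \<epsilon>" and h: "h holomorphic_on ball p \<epsilon>" and \<epsilon>: "0 < \<epsilon>"
    and nz: "h p \<noteq> 0" and w: "\<And>z. z \<in> ball p \<epsilon> \<Longrightarrow> w z = (z - p) ^ Suc n * h z"
  shows "residue (\<lambda>z. f z / w z) p = (deriv ^^ n) (\<lambda>z. f z / h z) p / fact n"
proof -
  have "isCont h p" using h \<epsilon> holomorphic_on_imp_continuous_on continuous_on_interior
    by (metis centre_in_ball interior_ball)
  then obtain \<delta> where \<delta>: "\<delta> > 0" "\<And>z. dist p z < \<delta> \<Longrightarrow> h z \<noteq> 0"
    using continuous_at_avoid[of p h 0] nz by auto
  let ?B = "ball p (min \<epsilon> \<delta>)"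
  have "residue (\<lambda>z. f z / w z) p = residue (\<lambda>z. (f z / h z) / (z - p) ^ Suc n) p"
  proof (rule residue_cong[OF _ refl])
    have "\<forall>\<^sub>F z in at p. z \<in> ball p \<epsilon>"
      using \<epsilon> by (intro eventually_at_in_open') auto
    thus "\<forall>\<^sub>F z in at p. f z / w z = f z / h z / (z - p) ^ Suc n"
      by eventually_elim (simp add: w mult.commute)
  qed
  also have "\<dots> = (deriv ^^ n) (\<lambda>z. f z / h z) p / fact n"
  proof (rule residue_holomorphic_over_power)
    show "(\<lambda>z. f z / h z) holomorphic_on ?B"
      by (intro holomorphic_intros holomorphic_on_subset[OF f] holomorphic_on_subset[OF h])
         (use \<delta> in auto)
  qed (use \<epsilon> \<delta> in auto)
  finally show ?thesis .
qed

text \<open>The factor \<open>exp (- \<bar>Im s\<bar> * (1 - x))\<close> of the quotient bound,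
  where \<open>s\<close> is a square root of the point with parameter \<open>t\<close> on the circle
  of radius \<open>radius N\<close>.\<close>

definition decay :: "nat \<Rightarrow> real \<Rightarrow> real \<Rightarrow> real" where
  "decay N x t = exp (- ((real N + 1/2) * pi / 2 * \<bar>sin (pi * t)\<bar> * (1 - x)))"

lemma decay_continuous: "continuous_on A (decay N x)"
  unfolding decay_def by (intro continuous_intros)

lemma decay_le_1: "x \<le> 1 \<Longrightarrow> decay N x t \<le> 1"
  by (simp add: decay_def)

lemma decay_integral_le_1: "x \<le> 1 \<Longrightarrow> integral {0..1} (decay N x) \<le> 1"
proof -
  assume x: "x \<le> 1"
  have "integral {0..1} (decay N x) \<le> integral {0..1} (\<lambda>t::real. 1)"
    by (intro integral_le integrable_continuous_interval decay_continuous decay_le_1 x) auto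
  thus ?thesis by simp
qed

text \<open>For \<open>0 < t < 1\<close> the sequence is geometric with ratio below 1. At the
  omitted end points the circle meets the positive real axis, where the square roots are real and
  nothing decays.\<close>

lemma decay_integral_tendsto_0:
  assumes x: "x < 1"
  shows "(\<lambda>N. integral {0..1} (decay N x)) \<longlonglongrightarrow> 0"
proof -
  have "(\<lambda>N. integral {0<..<1} (decay N x)) \<longlonglongrightarrow> integral {0<..<1} (\<lambda>t::real. 0::real)"
  proof (rule dominated_convergence(2))
    show "decay N x integrable_on {0<..<1}" for N
      unfolding integrable_on_open_interval_real
      by (intro integrable_continuous_interval decay_continuous)
    show "(\<lambda>t::real. 1::real) integrable_on {0<..<1}"
      unfolding integrable_on_open_interval_real by (intro integrable_continuous_interval) simp
    show "norm (decay N x t) \<le> 1" for N t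
      using x by (simp add: decay_def)
    fix t :: real assume t: "t \<in> {0<..<1}"
    define c where "c = pi / 2 * \<bar>sin (pi * t)\<bar> * (1 - x)"
    have "pi * t < pi * 1" using t by (intro mult_strict_left_mono) auto
    hence "sin (pi * t) > 0" using t by (intro sin_gt_zero) auto
    hence c: "c > 0" using x by (simp add: c_def)
    have "decay N x t = exp (- c / 2) * exp (- c) ^ N" for N
      by (simp add: decay_def c_def algebra_simps add_divide_distrib flip: exp_of_nat_mult exp_add)
    moreover have "(\<lambda>N. exp (- c / 2) * exp (- c) ^ N) \<longlonglongrightarrow> exp (- c / 2) * 0"
      by (intro tendsto_mult tendsto_const LIMSEQ_realpow_zero) (use c in auto)
    ultimately show "(\<lambda>N. decay N x t) \<longlonglongrightarrow> 0" by simp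
  qed
  thus ?thesis by (simp add: integral_open_interval_real)
qed

section \<open>Contour integrals and residues\<close>

context sl_problem
begin

lemma radius_pos: "0 < radius N"
  by (simp add: radius_def)

text \<open>The argument of the square root is avoided:
  \<open>cmod z - Re z = 2 * (Im s)\<^sup>2\<close> for \<open>s\<^sup>2 = z\<close>, and the left
  side is explicit on the circle.\<close>

lemma Im_csqrt_circlepath:
  "\<bar>Im (csqrt (circlepath 0 (radius N) t))\<bar> = (real N + 1/2) * pi / 2 * \<bar>sin (pi * t)\<bar>"
proof -
  define z s where "z = circlepath 0 (radius N) t" and "s = csqrt z"
  have s: "s\<^sup>2 = z" by (simp add: s_def)
  have z: "z = of_real (radius N) * exp (\<i> * of_real (2 * pi * t))"
    by (simp add: z_def circlepath mult_ac)
  have "cmod z = radius N" using radius_pos[of N] by (simp add: z norm_mult)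
  moreover have "Re z = radius N * cos (2 * pi * t)" by (simp add: z Re_exp)
  moreover have "cmod z = (Re s)\<^sup>2 + (Im s)\<^sup>2"
    by (simp add: s[symmetric] norm_power cmod_power2)
  moreover have "Re z = (Re s)\<^sup>2 - (Im s)\<^sup>2"
    by (simp only: s[symmetric] Re_power2)
  ultimately have "2 * (Im s)\<^sup>2 = radius N * (1 - cos (2 * pi * t))"
    unfolding right_diff_distrib by linarith
  also have "cos (2 * pi * t) = 1 - 2 * (sin (pi * t))\<^sup>2"
    using cos_double_sin[of "pi * t"] by (simp add: mult.assoc)
  finally have "(Im s)\<^sup>2 = ((real N + 1/2) * pi / 2)\<^sup>2 * (sin (pi * t))\<^sup>2"
    by (simp add: radius_def)
  hence "\<bar>Im s\<bar>\<^sup>2 = ((real N + 1/2) * pi / 2 * \<bar>sin (pi * t)\<bar>)\<^sup>2"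
    unfolding power_mult_distrib[of _ "\<bar>sin (pi * t)\<bar>"] power2_abs .
  hence "\<bar>Im s\<bar> = (real N + 1/2) * pi / 2 * \<bar>sin (pi * t)\<bar>"
    by (rule power2_eq_imp_eq) auto
  thus ?thesis by (simp only: s_def z_def)
qed

lemma circle_integral_bound:
  assumes K: "0 \<le> K" and x: "x \<in> {0..1}"
    and nz: "\<And>z. cmod z = radius N \<Longrightarrow> \<omega> z \<noteq> 0"
    and bd: "\<And>z. cmod z = radius N \<Longrightarrow>
      cmod (y x z / \<omega> z) \<le> K * exp (- \<bar>Im (csqrt z)\<bar> * (1 - x)) / radius N"
  shows "cmod (contour_integral (circlepath 0 (radius N)) (\<lambda>z. y x z / \<omega> z))
    \<le> 2 * pi * K * integral {0..1} (decay N x)"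
proof -
  let ?c = "circlepath 0 (radius N)"
  have cz: "cmod (?c t) = radius N" for t
    using radius_pos[of N] by (simp add: circlepath norm_mult norm_exp_eq_Re)
  have cont_c: "continuous_on {0..1} ?c"
    by (metis path_circlepath path_def)
  have cy: "continuous_on UNIV (y x)" "continuous_on UNIV \<omega>"
    by (intro holomorphic_on_imp_continuous_on y_holomorphic x omega_holomorphic)+
  have "cmod (integral {0..1} (\<lambda>t. y x (?c t) / \<omega> (?c t) * vector_derivative ?c (at t)))
      \<le> integral {0..1} (\<lambda>t. 2 * pi * K * decay N x t)"
  proof (rule integral_norm_bound_integral)
    show "(\<lambda>t. y x (?c t) / \<omega> (?c t) * vector_derivative ?c (at t)) integrable_on {0..1}"
      unfolding vector_derivative_circlepath using cz nz
      by (intro integrable_continuous_interval continuous_intros continuous_on_compose2[OF cy(1) cont_c]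
          continuous_on_compose2[OF cy(2) cont_c]) auto
    show "(\<lambda>t. 2 * pi * K * decay N x t) integrable_on {0..1}"
      by (intro integrable_continuous_interval continuous_intros decay_continuous)
    fix t :: real
    have "cmod (vector_derivative ?c (at t)) = 2 * pi * radius N"
      unfolding vector_derivative_circlepath using radius_pos[of N]
      by (simp add: norm_mult norm_exp_eq_Re)
    moreover have "cmod (y x (?c t) / \<omega> (?c t)) \<le> K * decay N x t / radius N"
      using bd[OF cz, of t] unfolding Im_csqrt_circlepath by (simp add: decay_def)
    ultimately have "cmod (y x (?c t) / \<omega> (?c t) * vector_derivative ?c (at t))
        \<le> K * decay N x t / radius N * (2 * pi * radius N)"
      unfolding norm_mult using radius_pos[of N] K by (intro mult_mono) (auto simp: decay_def)
    thus "cmod (y x (?c t) / \<omega> (?c t) * vector_derivative ?c (at t)) \<le> 2 * pi * K * decay N x t"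
      using radius_pos[of N] by (simp add: mult_ac)
  qed
  thus ?thesis by (simp add: contour_integral_integral)
qed

end

context sl_double
begin

text \<open>\<open>\<omega>\<close> has no zeros on the large circles but vanishes at eigenvalues,
  so it is not constant and has finitely many zeros in a compact disc.\<close>

lemma finite_omega_zeros: "finite {z. \<omega> z = 0 \<and> cmod z \<le> R}"
proof -
  obtain K N0 where KN: "\<forall>N\<ge>N0. \<forall>z. cmod z = radius N \<longrightarrow> \<omega> z \<noteq> 0"
    using quotient_bound_on_circles by blast
  have "\<omega> (of_real (radius N0)) \<noteq> 0"
    using KN[rule_format, of N0 "of_real (radius N0)"] radius_pos[of N0] by simp
  hence "\<not> \<omega> constant_on UNIV" using omega_lam[of k] by (metis constant_on_def UNIV_I)
  hence "finite {z \<in> cball 0 R. \<omega> z = 0}"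
    by (intro holomorphic_compact_finite_zeros[OF omega_holomorphic]) auto
  moreover have "{z \<in> cball 0 R. \<omega> z = 0} = {z. \<omega> z = 0 \<and> cmod z \<le> R}" by auto
  ultimately show ?thesis by simp
qed

lemma circle_integral_residues:
  assumes x: "x \<in> {0..1}" and R: "0 < R" and nz: "\<And>z. cmod z = R \<Longrightarrow> \<omega> z \<noteq> 0"
  shows "contour_integral (circlepath 0 R) (\<lambda>z. y x z / \<omega> z)
    = 2 * pi * \<i> * (\<Sum>p\<in>{z. \<omega> z = 0 \<and> cmod z < R}. residue (\<lambda>z. y x z / \<omega> z) p)"
proof -
  let ?c = "circlepath 0 R" and ?f = "\<lambda>z. y x z / \<omega> z"
  \<comment> \<open>The residue theorem needs an open set around the closed disc, so zeros in a
    slightly larger disc are removed as well; outside the circle their winding number is 0.\<close>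
  define P where "P = {z. \<omega> z = 0 \<and> cmod z < R + 1}"
  have finP: "finite P"
    by (rule finite_subset[OF _ finite_omega_zeros[of "R + 1"]]) (auto simp: P_def)
  have out: "winding_number ?c z = 0" if "R < cmod z" for z
    by (rule winding_number_zero_outside[of _ "cball 0 R"]) (use that R in auto)
  have "contour_integral ?c ?f = 2 * pi * \<i> * (\<Sum>p\<in>P. winding_number ?c p * residue ?f p)"
  proof (rule Residue_theorem[where S = "ball 0 (R + 1)"])
    show "?f holomorphic_on ball 0 (R + 1) - P"
      by (intro holomorphic_intros y_holomorphic omega_holomorphic x) (auto simp: P_def)
    show "path_image ?c \<subseteq> ball 0 (R + 1) - P" using R nz by (auto simp: P_def)
    show "\<forall>z. z \<notin> ball 0 (R + 1) \<longrightarrow> winding_number ?c z = 0" using out by simp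
  qed (use finP in auto)
  also have "(\<Sum>p\<in>P. winding_number ?c p * residue ?f p) = (\<Sum>p\<in>{z. \<omega> z = 0 \<and> cmod z < R}. residue ?f p)"
  proof (rule sum.mono_neutral_cong_right[OF finP])
    show "{z. \<omega> z = 0 \<and> cmod z < R} \<subseteq> P" by (auto simp: P_def)
    show "\<forall>p\<in>P - {z. \<omega> z = 0 \<and> cmod z < R}. winding_number ?c p * residue ?f p = 0"
    proof
      fix p assume "p \<in> P - {z. \<omega> z = 0 \<and> cmod z < R}"
      hence "\<not> cmod p < R" "cmod p \<noteq> R" using nz[of p] by (auto simp: P_def)
      hence "R < cmod p" by linarith
      thus "winding_number ?c p * residue ?f p = 0" by (simp add: out)
    qed
  qed (simp add: winding_number_circlepath)
  finally show ?thesis .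
qed

lemma residue_simple:
  assumes x: "x \<in> {0..1}" and n: "n \<notin> {k, Suc k}"
  shows "residue (\<lambda>z. y x z / \<omega> z) (lam n) = y x (lam n) / deriv \<omega> (lam n)"
proof -
  have d: "(deriv ^^ 1) \<omega> (lam n) \<noteq> 0" using lam_simple[OF n] by simp
  obtain h \<epsilon> where h: "0 < \<epsilon>" "h holomorphic_on ball (lam n) \<epsilon>"
    "\<And>z. z \<in> ball (lam n) \<epsilon> \<Longrightarrow> \<omega> z - \<omega> (lam n) = (z - lam n) ^ 1 * h z"
    "\<And>z. z \<in> ball (lam n) \<epsilon> \<Longrightarrow> h z \<noteq> 0"
    by (rule holomorphic_factor_order_of_zero[OF omega_holomorphic[of UNIV] open_UNIV _ _ d]) auto
  have res: "residue (\<lambda>z. y x z / \<omega> z) (lam n) = y x (lam n) / h (lam n)"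
    using residue_quotient_zero_order[OF y_holomorphic[OF x] h(2,1), of \<omega> 0] h omega_lam by simp
  have "((\<lambda>z. (z - lam n) * h z) has_field_derivative h (lam n)) (at (lam n))"
    using h by (auto intro!: derivative_eq_intros holomorphic_derivI[OF h(2)])
  hence "(\<omega> has_field_derivative h (lam n)) (at (lam n))"
    by (rule has_field_derivative_transform_within_open[where S = "ball (lam n) \<epsilon>"])
       (use h omega_lam in auto)
  thus ?thesis using res DERIV_imp_deriv by metis
qed

lemma residue_double:
  assumes x: "x \<in> {0..1}"
  shows "residue (\<lambda>z. y x z / \<omega> z) \<kappa> = (deriv (y x) \<kappa> - deriv g \<kappa> / g \<kappa> * y x \<kappa>) / g \<kappa>"
proof -
  have "residue (\<lambda>z. y x z / \<omega> z) \<kappa> = deriv (\<lambda>z. y x z / g z) \<kappa>"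
    using residue_quotient_zero_order[OF y_holomorphic[OF x] g_holo r g_nonzero, of \<omega> 1] omega_g
    by (simp add: power2_eq_square)
  also have "\<dots> = (deriv (y x) \<kappa> * g \<kappa> - y x \<kappa> * deriv g \<kappa>) / (g \<kappa> * g \<kappa>)"
    by (intro DERIV_imp_deriv DERIV_divide y_has_field_derivative[OF x] g_has_field_derivative g_nonzero)
  also have "\<dots> = (deriv (y x) \<kappa> - deriv g \<kappa> / g \<kappa> * y x \<kappa>) / g \<kappa>"
    using g_nonzero by (simp add: field_simps)
  finally show ?thesis .
qed

text \<open>Passes from zeros to indices: \<open>lam\<close> is injective off
  \<open>{k, Suc k}\<close>, and \<open>\<kappa>\<close>, listed twice, contributes a single
  residue.\<close>

lemma residue_sum:
  assumes x: "x \<in> {0..1}" and R: "cmod \<kappa> < R"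
  shows "(\<Sum>p\<in>{z. \<omega> z = 0 \<and> cmod z < R}. residue (\<lambda>z. y x z / \<omega> z) p)
    = (deriv (y x) \<kappa> - deriv g \<kappa> / g \<kappa> * y x \<kappa>) / g \<kappa>
      + (\<Sum>n | n \<notin> {k, Suc k} \<and> cmod (lam n) < R. y x (lam n) / deriv \<omega> (lam n))"
    and "finite {n. n \<notin> {k, Suc k} \<and> cmod (lam n) < R}"
proof -
  define J where "J = {n. n \<notin> {k, Suc k} \<and> cmod (lam n) < R}"
  define Z where "Z = {z. \<omega> z = 0 \<and> cmod z < R}"
  have inj: "inj_on lam J" by (rule inj_on_subset[OF lam_inj]) (auto simp: J_def)
  have img: "lam ` J = Z - {\<kappa>}"
  proof (intro equalityI subsetI)
    fix z assume "z \<in> Z - {\<kappa>}"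
    then obtain n where "z = lam n" "z \<noteq> \<kappa>" "cmod z < R" by (auto simp: Z_def omega_zero_iff)
    thus "z \<in> lam ` J" using lam_double by (auto simp: J_def)
  qed (use lam_other omega_lam in \<open>auto simp: J_def Z_def\<close>)
  have fZ: "finite Z"
    by (rule finite_subset[OF _ finite_omega_zeros[of R]]) (auto simp: Z_def)
  show "finite {n. n \<notin> {k, Suc k} \<and> cmod (lam n) < R}"
    unfolding J_def[symmetric] using img fZ inj by (metis finite_Diff finite_image_iff)
  have "\<kappa> \<in> Z" using R omega_lam by (simp add: Z_def)
  hence "(\<Sum>p\<in>Z. residue (\<lambda>z. y x z / \<omega> z) p)
    = residue (\<lambda>z. y x z / \<omega> z) \<kappa> + (\<Sum>p\<in>lam ` J. residue (\<lambda>z. y x z / \<omega> z) p)"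
    unfolding img by (rule sum.remove[OF fZ])
  also have "(\<Sum>p\<in>lam ` J. residue (\<lambda>z. y x z / \<omega> z) p) = (\<Sum>n\<in>J. y x (lam n) / deriv \<omega> (lam n))"
    unfolding sum.reindex[OF inj] comp_def by (rule sum.cong) (auto simp: J_def residue_simple[OF x])
  finally show "(\<Sum>p\<in>{z. \<omega> z = 0 \<and> cmod z < R}. residue (\<lambda>z. y x z / \<omega> z) p)
    = (deriv (y x) \<kappa> - deriv g \<kappa> / g \<kappa> * y x \<kappa>) / g \<kappa>
      + (\<Sum>n | n \<notin> {k, Suc k} \<and> cmod (lam n) < R. y x (lam n) / deriv \<omega> (lam n))"
    unfolding residue_double[OF x] Z_def J_def .
qed

lemma radius_unbounded: "\<exists>N0. \<forall>N\<ge>N0. B < radius N"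
proof -
  obtain N0 :: nat where N0: "B < real N0" "1 \<le> N0"
    by (metis reals_Archimedean2 less_le_trans max.cobounded1 max.cobounded2 of_nat_le_iff)
  have "B < radius N" if "N0 \<le> N" for N
  proof -
    have "real N \<le> real N * (pi / 2)" using pi_gt3 mult_left_mono[of 2 pi "real N"] by simp
    hence le: "real N \<le> (real N + 1/2) * pi / 2" using pi_gt3 by (simp add: distrib_right)
    have "B < real N" using N0 that by linarith
    also have "\<dots> \<le> (real N)\<^sup>2" using N0 that by (simp add: power2_eq_square)
    also have "\<dots> \<le> radius N" unfolding radius_def using le by (intro power_mono) auto
    finally show ?thesis .
  qed
  thus ?thesis by blast
qed

text \<open>For the critical value of \<open>C\<close> the residue of \<open>y / \<omega>\<close> at the double eigenvalue is a multiple of the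
  associated function, so that the residue theorem on growing circles yields a nontrivial
  linear relation \<open>\<Sum> F n / \<omega>' (lam n) + F (Suc k) / g \<kappa> = 0\<close> in \<open>L\<^sub>2\<close>.\<close>

lemma not_minimal_if:
  assumes C: "deriv g \<kappa> + of_real C * g \<kappa> = 0"
  shows "\<not> L2_minimal F (UNIV - {k})"
proof -
  \<comment> \<open>With this value the residue at \<open>\<kappa>\<close> is
    \<open>F (Suc k) x / g \<kappa>\<close>, free of a separate \<open>y_k\<close> term.\<close>
  have C': "deriv g \<kappa> / g \<kappa> = - of_real C"
  proof -
    have "deriv g \<kappa> = - of_real C * g \<kappa>" using C by (simp add: eq_neg_iff_add_eq_0)
    thus ?thesis using g_nonzero by simp
  qed
  obtain K N1 where K: "0 \<le> K" and N1: "\<And>N z. N1 \<le> N \<Longrightarrow> cmod z = radius N \<Longrightarrow> \<omega> z \<noteq> 0"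
    "\<And>N z x. N1 \<le> N \<Longrightarrow> cmod z = radius N \<Longrightarrow> x \<in> {0..1} \<Longrightarrow>
      cmod (y x z / \<omega> z) \<le> K * exp (- \<bar>Im (csqrt z)\<bar> * (1 - x)) / radius N"
    using quotient_bound_on_circles by blast
  obtain N2 where N2: "\<And>N. N2 \<le> N \<Longrightarrow> cmod \<kappa> < radius N"
    using radius_unbounded by blast
  define N0 where "N0 = max N1 N2"
  define J where "J = (\<lambda>N. {n. n \<notin> {k, Suc k} \<and> cmod (lam n) < radius N})"
  \<comment> \<open>The sum of residues times \<open>g \<kappa>\<close>, which gives
    \<open>F (Suc k)\<close> the coefficient 1; \<open>E N\<close> is then the error of an
    approximation from the span of the other elements.\<close>
  define E where "E = (\<lambda>N x. F (Suc k) x - (\<Sum>n\<in>J N. - g \<kappa> / deriv \<omega> (lam n) * F n x))"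
  define B where "B = cmod (g \<kappa>) * K"
  have B: "0 \<le> B" using K by (simp add: B_def)
  have finJ: "finite (J N)" if "N0 \<le> N" for N
    unfolding J_def using residue_sum(2)[of 0 "radius N"] N2[of N] that by (simp add: N0_def)
  have E: "cmod (E N x) \<le> B * integral {0..1} (decay N x)" if N: "N0 \<le> N" and x: "x \<in> {0..1}" for N x
  proof -
    let ?I = "contour_integral (circlepath 0 (radius N)) (\<lambda>z. y x z / \<omega> z)"
    have "?I = 2 * pi * \<i> * ((deriv (y x) \<kappa> - deriv g \<kappa> / g \<kappa> * y x \<kappa>) / g \<kappa>
        + (\<Sum>n\<in>J N. y x (lam n) / deriv \<omega> (lam n)))"
      unfolding J_def using N N1(1)[of N] N2[of N]
      by (subst circle_integral_residues[OF x radius_pos]) (auto simp: residue_sum(1)[OF x] N0_def)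
    also have "deriv (y x) \<kappa> - deriv g \<kappa> / g \<kappa> * y x \<kappa> = F (Suc k) x"
      by (simp add: C' root_system_def)
    also have "(\<Sum>n\<in>J N. y x (lam n) / deriv \<omega> (lam n)) = (\<Sum>n\<in>J N. F n x / deriv \<omega> (lam n))"
      by (rule sum.cong) (auto simp: J_def root_system_def)
    finally have "g \<kappa> * ?I = 2 * pi * \<i> * (F (Suc k) x + (\<Sum>n\<in>J N. g \<kappa> * (F n x / deriv \<omega> (lam n))))"
      using g_nonzero by (simp add: distrib_left sum_distrib_left mult.left_commute)
    also have "F (Suc k) x + (\<Sum>n\<in>J N. g \<kappa> * (F n x / deriv \<omega> (lam n))) = E N x"
      by (simp add: E_def sum_negf)
    finally have "g \<kappa> * ?I = 2 * pi * \<i> * E N x" .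
    from arg_cong[OF this, of cmod] have "cmod (g \<kappa>) * cmod ?I = 2 * pi * cmod (E N x)"
      by (simp add: norm_mult)
    moreover have "cmod (g \<kappa>) * cmod ?I \<le> cmod (g \<kappa>) * (2 * pi * K * integral {0..1} (decay N x))"
      using N by (intro mult_left_mono circle_integral_bound K x N1) (auto simp: N0_def)
    ultimately have "2 * pi * cmod (E N x) \<le> 2 * pi * (B * integral {0..1} (decay N x))"
      by (simp add: B_def mult_ac)
    thus ?thesis by simp
  qed
  have cE: "continuous_on {0..1} (E N)" for N
    unfolding E_def by (intro continuous_intros cont_F)
  \<comment> \<open>The shift by \<open>N0\<close> makes the bounds valid for every
    \<open>N\<close>. The bound on \<open>E\<close> does not decay at \<open>x = 1\<close>, so the
    convergence obtained is pointwise on the open interval under the majorant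
    \<open>B\<^sup>2\<close>.\<close>
  have lim: "(\<lambda>N. integral {0<..<1} (\<lambda>x. (cmod (E (N + N0) x))\<^sup>2)) \<longlonglongrightarrow> integral {0<..<1} (\<lambda>x::real. 0::real)"
  proof (rule dominated_convergence(2))
    show "(\<lambda>x. (cmod (E (N + N0) x))\<^sup>2) integrable_on {0<..<1}" for N
      unfolding integrable_on_open_interval_real
      by (intro integrable_continuous_interval continuous_intros cE)
    show "(\<lambda>x::real. B\<^sup>2) integrable_on {0<..<1}"
      unfolding integrable_on_open_interval_real by (intro integrable_continuous_interval) simp
    fix x :: real assume x: "x \<in> {0<..<1}"
    hence x': "x \<in> {0..1}" "x \<le> 1" "x < 1" by auto
    show "norm ((cmod (E (N + N0) x))\<^sup>2) \<le> B\<^sup>2" for N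
    proof -
      have "cmod (E (N + N0) x) \<le> B * integral {0..1} (decay (N + N0) x)"
        by (rule E) (use x' in auto)
      also have "\<dots> \<le> B" using decay_integral_le_1[OF x'(2)] B by (simp add: mult_left_le)
      finally show ?thesis by (simp add: power_mono)
    qed
    have "(\<lambda>N. cmod (E (N + N0) x)) \<longlonglongrightarrow> 0"
    proof (rule Lim_null_comparison)
      show "\<forall>\<^sub>F N in sequentially. norm (cmod (E (N + N0) x)) \<le> B * integral {0..1} (decay (N + N0) x)"
        using E[OF _ x'(1)] by (intro always_eventually allI) simp
      have "(\<lambda>N. B * integral {0..1} (decay (N + N0) x)) \<longlonglongrightarrow> B * 0"
        by (intro tendsto_intros LIMSEQ_ignore_initial_segment[OF decay_integral_tendsto_0[OF x'(3)]])
      thus "(\<lambda>N. B * integral {0..1} (decay (N + N0) x)) \<longlonglongrightarrow> 0" by simp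
    qed
    hence "(\<lambda>N. (cmod (E (N + N0) x))\<^sup>2) \<longlonglongrightarrow> 0\<^sup>2" by (rule tendsto_power)
    thus "(\<lambda>N. (cmod (E (N + N0) x))\<^sup>2) \<longlonglongrightarrow> 0" by simp
  qed
  have lim': "(\<lambda>N. L2_norm (E (N + N0))) \<longlonglongrightarrow> 0"
    unfolding L2_norm_continuous[OF cE] using tendsto_real_sqrt[OF lim]
    by (simp add: integral_open_interval_real)
  have "F (Suc k) \<in> L2_closed_span F (UNIV - {k} - {Suc k})"
    unfolding L2_closed_span_def
  proof (intro CollectI conjI allI impI)
    show "F (Suc k) \<in> L2_01" by (rule continuous_in_L2_01[OF cont_F])
    fix e :: real assume "e > 0"
    hence "\<forall>\<^sub>F N in sequentially. L2_norm (E (N + N0)) < e"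
      using lim' by (intro order_tendstoD)
    then obtain N where N: "L2_norm (E (N + N0)) < e" by (auto simp: eventually_sequentially)
    show "\<exists>I \<alpha>. finite I \<and> I \<subseteq> UNIV - {k} - {Suc k} \<and>
        L2_norm (\<lambda>x. F (Suc k) x - (\<Sum>j\<in>I. \<alpha> j * F j x)) < e"
      using N finJ[of "N + N0"]
      by (intro exI[of _ "J (N + N0)"] exI[of _ "\<lambda>n. - g \<kappa> / deriv \<omega> (lam n)"])
         (auto simp: E_def J_def)
  qed
  thus ?thesis unfolding L2_minimal_def by auto
qed

end

section \<open>From orders of zeros to the factorisation at the double eigenvalue\<close>

lemma zorder_factor:
  assumes f: "f holomorphic_on UNIV" and nz: "f w \<noteq> 0" and n: "zorder f p = int n"
  obtains h \<epsilon> where "0 < \<epsilon>" "h holomorphic_on ball p \<epsilon>" "h p \<noteq> 0"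
    "\<And>z. z \<in> ball p \<epsilon> \<Longrightarrow> f z = (z - p) ^ n * h z"
proof -
  obtain \<epsilon> where \<epsilon>: "0 < \<epsilon>" "zor_poly f p holomorphic_on cball p \<epsilon>"
    "\<And>z. z \<in> cball p \<epsilon> \<Longrightarrow> f z = zor_poly f p z * (z - p) ^ nat (zorder f p) \<and> zor_poly f p z \<noteq> 0"
    using zorder_exist_zero[OF f open_UNIV connected_UNIV UNIV_I, of p] nz by blast
  show ?thesis
  proof (rule that)
    show "zor_poly f p holomorphic_on ball p \<epsilon>"
      by (rule holomorphic_on_subset[OF \<epsilon>(2)]) auto
    show "f z = (z - p) ^ n * zor_poly f p z" if "z \<in> ball p \<epsilon>" for z
      using \<epsilon>(3)[of z] that by (simp add: n)
  qed (use \<epsilon> in auto)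
qed

text \<open>In Leibniz's rule only the second derivative of \<open>(z - p)\<^sup>2\<close> survives
  at \<open>p\<close>, so the coefficients are \<open>2 * (n choose 2)\<close> for
  \<open>n = 2, 3\<close>.\<close>

lemma higher_deriv_double_zero:
  fixes f g :: "complex \<Rightarrow> complex"
  assumes g: "g holomorphic_on ball p \<epsilon>" and \<epsilon>: "0 < \<epsilon>"
    and f: "f holomorphic_on ball p \<epsilon>" "\<And>z. z \<in> ball p \<epsilon> \<Longrightarrow> f z = (z - p)\<^sup>2 * g z"
  shows "(deriv ^^ 2) f p = 2 * g p" "(deriv ^^ 3) f p = 6 * deriv g p"
proof -
  have *: "(deriv ^^ n) f p = (\<Sum>i = 0..n. of_nat (n choose i) *
      (pochhammer (of_nat (Suc 2 - i)) i * (p - p) ^ (2 - i)) * (deriv ^^ (n - i)) g p)" for n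
  proof -
    have "(deriv ^^ n) f p = (deriv ^^ n) (\<lambda>z. (z - p)\<^sup>2 * g z) p"
      by (rule higher_deriv_transform_within_open[of _ "ball p \<epsilon>"])
         (use f g \<epsilon> in \<open>auto intro!: holomorphic_intros\<close>)
    also have "\<dots> = (\<Sum>i = 0..n. of_nat (n choose i) * (deriv ^^ i) (\<lambda>z. (z - p)\<^sup>2) p * (deriv ^^ (n - i)) g p)"
      by (rule higher_deriv_mult[of _ "ball p \<epsilon>"]) (use g \<epsilon> in \<open>auto intro!: holomorphic_intros\<close>)
    finally show ?thesis by (simp only: higher_deriv_power)
  qed
  show "(deriv ^^ 2) f p = 2 * g p"
    unfolding * by (simp add: numeral_2_eq_2 numeral_3_eq_3 pochhammer_Suc)
  show "(deriv ^^ 3) f p = 6 * deriv g p"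
    unfolding * by (simp add: numeral_2_eq_2 numeral_3_eq_3 pochhammer_Suc)
qed

context sl_problem
begin

lemma minimal_iff:
  fixes lam :: "nat \<Rightarrow> complex" and k :: nat and C :: real
  assumes enum: "zero_enumeration \<omega> lam"
    and real: "\<And>n. lam n \<in> \<real>"
    and double: "lam k = lam (Suc k)" "zorder \<omega> (lam k) = 2"
    and simple: "\<And>n. n \<noteq> k \<Longrightarrow> n \<noteq> Suc k \<Longrightarrow> zorder \<omega> (lam n) = 1"
  shows "L2_minimal (root_system y lam k C) (UNIV - {k}) \<longleftrightarrow>
      complex_of_real C \<noteq> - ((deriv ^^ 3) \<omega> (lam k) / (3 * (deriv ^^ 2) \<omega> (lam k)))"
proof -
  have zeros: "\<omega> z = 0 \<longleftrightarrow> z \<in> range lam" for z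
    using enum by (auto simp: zero_enumeration_def)
  have card: "finite {i. lam i = lam n}" "int (card {i. lam i = lam n}) = zorder \<omega> (lam n)" for n
    using enum zeros[of "lam n"] by (auto simp: zero_enumeration_def)
  \<comment> \<open>All zeros are real, so \<open>\<i>\<close> witnesses that
    \<open>\<omega>\<close> is not identically zero, as the factorisation by \<open>zorder\<close>
    requires.\<close>
  have nz: "\<omega> \<i> \<noteq> 0"
  proof
    assume "\<omega> \<i> = 0"
    then obtain n where "\<i> = lam n" using zeros by auto
    with real[of n] show False by (auto simp: complex_is_Real_iff dest: arg_cong[of _ _ Im])
  qed
  \<comment> \<open>The fibre has as many elements as the order 2 of the zero and already contains
    these two indices.\<close>
  have "{k, Suc k} = {i. lam i = lam k}"
    using card[of k] double by (intro card_subset_eq) auto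
  hence other: "lam n \<noteq> lam k" if "n \<notin> {k, Suc k}" for n using that by auto
  have inj: "inj_on lam (- {k, Suc k})"
  proof (rule inj_onI)
    fix n m assume nm: "n \<in> - {k, Suc k}" "m \<in> - {k, Suc k}" "lam n = lam m"
    have "card {i. lam i = lam n} = 1" using card(2)[of n] simple[of n] nm by simp
    then obtain j where "{i. lam i = lam n} = {j}" by (rule card_1_singletonE)
    thus "n = m" using nm by (metis (mono_tags, lifting) mem_Collect_eq singletonD)
  qed
  have deriv_nz: "deriv \<omega> (lam n) \<noteq> 0" if "n \<notin> {k, Suc k}" for n
  proof -
    have z: "zorder \<omega> (lam n) = int 1" using simple that by auto
    obtain h \<epsilon> where h: "0 < \<epsilon>" "h holomorphic_on ball (lam n) \<epsilon>" "h (lam n) \<noteq> 0"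
      "\<And>z. z \<in> ball (lam n) \<epsilon> \<Longrightarrow> \<omega> z = (z - lam n) ^ 1 * h z"
      by (rule zorder_factor[OF omega_holomorphic nz z]) auto
    have "((\<lambda>z. (z - lam n) * h z) has_field_derivative h (lam n)) (at (lam n))"
      using h by (auto intro!: derivative_eq_intros holomorphic_derivI[OF h(2)])
    hence "(\<omega> has_field_derivative h (lam n)) (at (lam n))"
      by (rule has_field_derivative_transform_within_open[where S = "ball (lam n) \<epsilon>"])
         (use h in auto)
    thus ?thesis using h(3) DERIV_imp_deriv by metis
  qed
  have z: "zorder \<omega> (lam k) = int 2" using double by simp
  obtain g r where g: "0 < r" "g holomorphic_on ball (lam k) r" "g (lam k) \<noteq> 0"
    "\<And>z. z \<in> ball (lam k) r \<Longrightarrow> \<omega> z = (z - lam k)\<^sup>2 * g z"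
    by (rule zorder_factor[OF omega_holomorphic nz z]) blast
  have hd: "(deriv ^^ 2) \<omega> (lam k) = 2 * g (lam k)" "(deriv ^^ 3) \<omega> (lam k) = 6 * deriv g (lam k)"
    using higher_deriv_double_zero[OF g(2,1) omega_holomorphic g(4)] by blast+
  interpret D: sl_double q \<beta> y dy a b c d lam k C g r
    by unfold_locales (use zeros double other inj deriv_nz g in auto)
  have "L2_minimal (root_system y lam k C) (UNIV - {k}) \<longleftrightarrow> deriv g (lam k) + of_real C * g (lam k) \<noteq> 0"
    using D.minimal_if D.not_minimal_if by blast
  also have "\<dots> \<longleftrightarrow> complex_of_real C \<noteq> - (deriv g (lam k) / g (lam k))"
    using g(3) by (auto simp: field_simps eq_neg_iff_add_eq_0)
  also have "deriv g (lam k) / g (lam k) = (deriv ^^ 3) \<omega> (lam k) / (3 * (deriv ^^ 2) \<omega> (lam k))"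
    unfolding hd by simp
  finally show ?thesis .
qed

end

theorem theorem6p1:
  fixes q :: "real \<Rightarrow> real" and \<beta> a b c d C :: real
    and y dy :: "real \<Rightarrow> complex \<Rightarrow> complex"
    and \<omega> :: "complex \<Rightarrow> complex"
    and lam :: "nat \<Rightarrow> complex" and k :: nat
  assumes "continuous_on {0..1} q"
    and "0 \<le> \<beta>" and "\<beta> < pi"
    and "a * d - b * c < 0"
    and "\<And>\<mu>. sl_solution q \<mu> (\<lambda>x. y x \<mu>) (\<lambda>x. dy x \<mu>)"
    and "\<And>\<mu>. y 0 \<mu> = complex_of_real (sin \<beta>)"
    and "\<And>\<mu>. dy 0 \<mu> = complex_of_real (cos \<beta>)"
    and "\<omega> = char_fun a b c d y dy"
    and "zero_enumeration \<omega> lam"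
    and "\<And>n. lam n \<in> \<real>"
    and "lam k = lam (Suc k)" and "zorder \<omega> (lam k) = 2"
    and "\<And>n. n \<noteq> k \<Longrightarrow> n \<noteq> Suc k \<Longrightarrow> zorder \<omega> (lam n) = 1"
  shows "L2_minimal (root_system y lam k C) (UNIV - {k}) \<longleftrightarrow>
           complex_of_real C \<noteq> - ((deriv ^^ 3) \<omega> (lam k) / (3 * (deriv ^^ 2) \<omega> (lam k)))"
proof -
  interpret P: sl_problem q \<beta> y dy a b c d
    by unfold_locales (use assms in auto)
  show ?thesis
    unfolding \<open>\<omega> = char_fun a b c d y dy\<close>
    by (rule P.minimal_iff) (use assms in auto)
qed

end
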